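(* Let $V$ be a (finite-dimensional) real orthogonal representation of the compact group $G$, and let $\mathbb{R}[V]^G$ denote its algebra of invariants. Let $\mathcal{S}\subset\mathbb{R}[V]^G$ be a separating set containing $r^2$, and let $B$ be the sub-algebra of $\mathbb{R}[V]$ generated by $\mathcal{S}$. Then $B=\mathbb{R}[V]^G$ if and only if $\Delta f\in B$ and $\langle\nabla f,\nabla g\rangle\in B$ for every $f,g\in\mathcal{S}$.
   Context: $V$ is a finite-dimensional real inner product space on which the compact group $G$ acts by orthogonal transformations; $\mathbb{R}[V]$ is the algebra of real polynomial functions on $V$, and $\mathbb{R}[V]^G$ the sub-algebra of $G$-invariant polynomials. In orthonormal coordinates $x_1,\dots,x_n$ on $V$: $r^2=\sum_i x_i^2$, $\Delta=\sum_i\partial^2/\partial x_i^2$, and $\langle\nabla f,\nabla g\rangle=\sum_i\frac{\partial f}{\partial x_i}\frac{\partial g}{\partial x_i}$. A set $\mathcal{S}$ of $G$-invariant polynomials is called separating if it separates $G$-orbits: for any two points $v,w$ in different $G$-orbits there is $f\in\mathcal{S}$ with $f(v)\neq f(w)$. *)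

theory Defs
  imports "HOL-Analysis.Analysis" "HOL-Algebra.Group_Action"
begin

(* The topology need not be Hausdorff. *)
definition compact_group :: "('g, 'm) monoid_scheme \<Rightarrow> 'g topology \<Rightarrow> bool" where
  "compact_group G T \<longleftrightarrow>
     group G \<and> topspace T = carrier G \<and>
     continuous_map (prod_topology T T) T (\<lambda>(g, h). g \<otimes>\<^bsub>G\<^esub> h) \<and>
     continuous_map T T (\<lambda>g. inv\<^bsub>G\<^esub> g) \<and>
     compact_space T"

definition orthogonal_representation ::
  "('g, 'm) monoid_scheme \<Rightarrow> 'g topology \<Rightarrow> ('g \<Rightarrow> 'v \<Rightarrow> 'v::real_inner) \<Rightarrow> bool" where
  "orthogonal_representation G T \<rho> \<longleftrightarrow>
     group_action G UNIV \<rho> \<and>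
     (\<forall>g\<in>carrier G. orthogonal_transformation (\<rho> g)) \<and>
     continuous_map (prod_topology T euclidean) euclidean (\<lambda>(g, v). \<rho> g v)"

(* An orthonormal basis plays the role of the orthonormal coordinates on V: the coordinate
   of v along e is v \<bullet> e. Its existence makes V finite-dimensional. The class real_inner is
   used instead of euclidean_space because the latter excludes the zero space. *)
definition orthonormal_basis :: "'v::real_inner set \<Rightarrow> bool" where
  "orthonormal_basis E \<longleftrightarrow>
     finite E \<and> pairwise orthogonal E \<and> (\<forall>e\<in>E. norm e = 1) \<and> span E = UNIV"

definition r_squared :: "'v::real_inner set \<Rightarrow> 'v \<Rightarrow> real" where
  "r_squared E v = (\<Sum>e\<in>E. (v \<bullet> e)\<^sup>2)"

definition partial_deriv :: "'v::real_inner \<Rightarrow> ('v \<Rightarrow> real) \<Rightarrow> 'v \<Rightarrow> real" where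
  "partial_deriv e f v = deriv (\<lambda>t. f (v + t *\<^sub>R e)) 0"

definition laplacian :: "'v::real_inner set \<Rightarrow> ('v \<Rightarrow> real) \<Rightarrow> 'v \<Rightarrow> real" where
  "laplacian E f v = (\<Sum>e\<in>E. partial_deriv e (partial_deriv e f) v)"

definition grad_inner :: "'v::real_inner set \<Rightarrow> ('v \<Rightarrow> real) \<Rightarrow> ('v \<Rightarrow> real) \<Rightarrow> 'v \<Rightarrow> real" where
  "grad_inner E f g v = (\<Sum>e\<in>E. partial_deriv e f v * partial_deriv e g v)"

definition invariant_polys ::
  "('g, 'm) monoid_scheme \<Rightarrow> ('g \<Rightarrow> 'v \<Rightarrow> 'v::real_inner) \<Rightarrow> ('v \<Rightarrow> real) set" where
  "invariant_polys G \<rho> =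
     {f. real_polynomial_function f \<and> (\<forall>g\<in>carrier G. \<forall>v. f (\<rho> g v) = f v)}"

definition separating ::
  "('g, 'm) monoid_scheme \<Rightarrow> ('g \<Rightarrow> 'v \<Rightarrow> 'v::real_inner) \<Rightarrow> ('v \<Rightarrow> real) set \<Rightarrow> bool" where
  "separating G \<rho> S \<longleftrightarrow>
     S \<subseteq> invariant_polys G \<rho> \<and>
     (\<forall>v w. orbit G \<rho> v \<noteq> orbit G \<rho> w \<longrightarrow> (\<exists>f\<in>S. f v \<noteq> f w))"

(* Subalgebras are unital, so closure under scalar multiples follows from the constants. *)
definition function_subalgebra :: "('v \<Rightarrow> real) set \<Rightarrow> bool" where
  "function_subalgebra A \<longleftrightarrow>
     (\<forall>c. (\<lambda>_. c) \<in> A) \<and>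
     (\<forall>f\<in>A. \<forall>g\<in>A. (\<lambda>v. f v + g v) \<in> A \<and> (\<lambda>v. f v * g v) \<in> A)"

(* For S a set of polynomial functions this lies inside the polynomial functions,
   as these form a subalgebra. *)
definition generated_subalgebra :: "('v \<Rightarrow> real) set \<Rightarrow> ('v \<Rightarrow> real) set" where
  "generated_subalgebra S = function_subalgebra hull S"

end

theory Submission
  imports Defs
begin

text \<open>Write \<open>A\<close> for the algebra of invariants. The Laplacian and the inner product of gradients do not
depend on the orthonormal basis, so they commute with orthogonal transformations and map \<open>A\<close> to
itself; this gives one direction.

For the other direction, call a subalgebra of the polynomial functions a Laplacian algebra if it
contains \<open>r\<^sup>2\<close> and is closed under the Laplacian and under the inner product of gradients. The product
rules extend closure from the generators \<open>S\<close> to all of \<open>B\<close>, so that \<open>B\<close> and \<open>A\<close> are both Laplacian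
algebras, \<open>B\<close> lies in \<open>A\<close>, and functions of \<open>A\<close> are constant on the common fibres of \<open>B\<close>, because
\<open>S\<close> separates orbits. These properties alone force \<open>B = A\<close>
(\<open>laplacian_algebra_eq_if_same_fibres\<close>), for the following reason.

The inner product of the gradients of \<open>r\<^sup>2\<close> and \<open>f\<close> is twice the Euler operator applied to \<open>f\<close>, so a
Laplacian algebra contains the homogeneous components of its elements. Since
\<open>\<Delta>\<^sup>k (r\<^sup>2\<^sup>k h)\<close> is a positive multiple of \<open>h\<close> for \<open>h\<close> harmonic and homogeneous, it also contains the
harmonic components: each element is a sum of terms \<open>r\<^sup>2\<^sup>k h\<close> with \<open>h\<close> a harmonic homogeneous
element of the algebra (\<open>laplacian_algebra_induct\<close>). It remains to show that a harmonic
\<open>h \<in> A\<close>, homogeneous of degree \<open>d\<close>, lies in \<open>B\<close> (\<open>harmonic_mem_separating_subalgebra\<close>). After subtracting an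
orthogonal projection, \<open>h\<close> is orthogonal to the harmonic elements of degree \<open>d\<close> in \<open>B\<close>. Harmonic
polynomials of different degrees are orthogonal on the unit sphere, so \<open>h\<close> is orthogonal to all
of \<open>B\<close> there. By the Stone--Weierstrass theorem \<open>h\<close> is a uniform limit on the sphere of
elements of \<open>B\<close>, hence orthogonal to itself, and so zero.

Orthogonality on the sphere is expressed without integration. By Pizzetti's formula the mean of a
polynomial \<open>f\<close> over the unit sphere is a linear combination of the values at the origin of the iterated Laplacians of \<open>f\<close>,
and this combination is taken as the definition of the mean. It is bounded by the
maximum of \<open>f\<close> on the sphere (\<open>mean_le_sphere\<close>), since it equals the value at the origin of a
harmonic polynomial that agrees with \<open>f\<close> on the sphere, to which the maximum principle applies.
On products of harmonic polynomials it is a multiple of the sum over the products of their partial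
derivatives of top order (\<open>mean_mult_harmonic\<close>), which makes positivity evident.\<close>

section \<open>Derivatives of polynomial functions\<close>

abbreviation polyfun :: "('v::real_inner \<Rightarrow> real) \<Rightarrow> bool" where
  "polyfun \<equiv> real_polynomial_function"

lemmas polyfun_linear = real_polynomial_function.intros(1)
  and polyfun_const = real_polynomial_function.intros(2)
  and polyfun_add = real_polynomial_function.intros(3)
  and polyfun_mult = real_polynomial_function.intros(4)

lemma polyfun_frechet:
  assumes "polyfun f"
  obtains D where "(f has_derivative D) (at v)"
  using differentiable_at_real_polynomial_function[OF assms] unfolding differentiable_def by blast

lemma has_derivative_along_line:
  fixes f :: "'v::real_inner \<Rightarrow> real"
  assumes "(f has_derivative D) (at (v + s *\<^sub>R e))"
  shows "((\<lambda>t. f (v + t *\<^sub>R e)) has_real_derivative D e) (at s)"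
proof -
  have D: "bounded_linear D" using assms by (rule has_derivative_bounded_linear)
  have "((\<lambda>t. f (v + t *\<^sub>R e)) has_derivative (\<lambda>t. D (t *\<^sub>R e))) (at s)"
    by (rule has_derivative_compose[where f="\<lambda>t. v + t *\<^sub>R e" and g=f])
       (auto intro!: derivative_eq_intros assms)
  moreover have "(\<lambda>t. D (t *\<^sub>R e)) = (*) (D e)"
    using D by (auto simp: linear_simps)
  ultimately show ?thesis by (simp add: has_field_derivative_def)
qed

lemma partial_deriv_frechet:
  assumes "(f has_derivative D) (at v)"
  shows "partial_deriv e f v = D e"
  unfolding partial_deriv_def
  using assms by (intro DERIV_imp_deriv has_derivative_along_line) simp

text \<open>Moving the base point along the line turns the derivative at parameter \<open>0\<close>, which defines the
partial derivative, into the derivative at every parameter; the second derivative test for maxima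
uses this.\<close>

lemma partial_deriv_line:
  assumes "polyfun f"
  shows "((\<lambda>t. f (v + t *\<^sub>R e)) has_real_derivative partial_deriv e f (v + s *\<^sub>R e)) (at s)"
proof -
  obtain D where D: "(f has_derivative D) (at (v + s *\<^sub>R e))" using polyfun_frechet[OF assms] .
  show ?thesis using has_derivative_along_line[OF D] partial_deriv_frechet[OF D, of e] by simp
qed

lemma partial_deriv_linear:
  "bounded_linear f \<Longrightarrow> partial_deriv e f = (\<lambda>v. f e)"
  by (rule ext) (rule partial_deriv_frechet, rule bounded_linear_imp_has_derivative)

lemma partial_deriv_const: "partial_deriv e (\<lambda>v. c) = (\<lambda>v. 0)"
  by (rule ext) (rule partial_deriv_frechet, rule has_derivative_const)

lemma partial_deriv_add:
  assumes "polyfun f" "polyfun g"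
  shows "partial_deriv e (\<lambda>v. f v + g v) = (\<lambda>v. partial_deriv e f v + partial_deriv e g v)"
proof
  fix v
  obtain D where D: "(f has_derivative D) (at v)" using polyfun_frechet[OF assms(1)] .
  obtain D' where D': "(g has_derivative D') (at v)" using polyfun_frechet[OF assms(2)] .
  show "partial_deriv e (\<lambda>v. f v + g v) v = partial_deriv e f v + partial_deriv e g v"
    using partial_deriv_frechet[OF has_derivative_add[OF D D']]
    by (simp add: partial_deriv_frechet[OF D] partial_deriv_frechet[OF D'])
qed

lemma partial_deriv_mult:
  assumes "polyfun f" "polyfun g"
  shows "partial_deriv e (\<lambda>v. f v * g v) =
    (\<lambda>v. f v * partial_deriv e g v + partial_deriv e f v * g v)"
proof
  fix v
  obtain D where D: "(f has_derivative D) (at v)" using polyfun_frechet[OF assms(1)] .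
  obtain D' where D': "(g has_derivative D') (at v)" using polyfun_frechet[OF assms(2)] .
  show "partial_deriv e (\<lambda>v. f v * g v) v = f v * partial_deriv e g v + partial_deriv e f v * g v"
    using partial_deriv_frechet[OF has_derivative_mult[OF D D']]
    by (simp add: partial_deriv_frechet[OF D] partial_deriv_frechet[OF D'])
qed

lemma partial_deriv_cmult:
  assumes "polyfun f"
  shows "partial_deriv e (\<lambda>v. c * f v) = (\<lambda>v. c * partial_deriv e f v)"
  using partial_deriv_mult[OF polyfun_const assms, of e c]
  by (simp add: partial_deriv_const)

lemma polyfun_partial_deriv: "polyfun f \<Longrightarrow> polyfun (partial_deriv e f)"
proof (induction rule: real_polynomial_function.induct)
  case (linear f)
  then show ?case by (simp add: partial_deriv_linear polyfun_const)
next
  case (const c)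
  then show ?case by (simp add: partial_deriv_const polyfun_const)
next
  case (add f g)
  then show ?case by (simp add: partial_deriv_add polyfun_add)
next
  case (mult f g)
  then show ?case
    by (auto simp: partial_deriv_mult intro!: polyfun_add polyfun_mult)
qed

lemma partial_deriv_sum:
  assumes "finite I" "\<And>i. i \<in> I \<Longrightarrow> polyfun (f i)"
  shows "partial_deriv e (\<lambda>v. \<Sum>i\<in>I. f i v) = (\<lambda>v. \<Sum>i\<in>I. partial_deriv e (f i) v)"
  using assms
proof (induction rule: finite_induct)
  case empty
  then show ?case by (simp add: partial_deriv_const)
next
  case (insert i I)
  have "polyfun (\<lambda>v. \<Sum>i\<in>I. f i v)" using insert by (auto intro: real_polynomial_function_sum)
  then show ?case using insert by (simp add: partial_deriv_add)
qed

lemma partial_deriv_commute: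
  "polyfun f \<Longrightarrow> partial_deriv a (partial_deriv b f) = partial_deriv b (partial_deriv a f)"
proof (induction rule: real_polynomial_function.induct)
  case (linear f)
  then show ?case by (simp add: partial_deriv_linear partial_deriv_const)
next
  case (const c)
  then show ?case by (simp add: partial_deriv_const)
next
  case (add f g)
  then show ?case by (simp add: partial_deriv_add polyfun_partial_deriv)
next
  case (mult f g)
  then show ?case
    by (simp add: partial_deriv_add partial_deriv_mult polyfun_partial_deriv
        polyfun_mult algebra_simps)
qed

lemma polyfun_inner: "polyfun (\<lambda>v. v \<bullet> a)"
  by (intro polyfun_linear bounded_linear_inner_left)

text \<open>Directional derivatives of a polynomial come from a Frechet derivative. This linearity is behind
both Euler's identity and the independence of the Laplacian from the basis.\<close>

lemma partial_deriv_direction_linear: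
  assumes "polyfun f"
  shows "linear (\<lambda>e. partial_deriv e f v)"
proof -
  obtain D where D: "(f has_derivative D) (at v)" using polyfun_frechet[OF assms] .
  have "(\<lambda>e. partial_deriv e f v) = D" using partial_deriv_frechet[OF D] by auto
  then show ?thesis using has_derivative_linear[OF D] by simp
qed

lemma continuous_on_polyfun: "polyfun f \<Longrightarrow> continuous_on S f"
  by (rule continuous_on_polymonial_function) (simp add: real_polynomial_function_eq[symmetric])

section \<open>Orthonormal bases\<close>

locale orthonormal_coordinates =
  fixes E :: "'v::real_inner set"
  assumes basis: "orthonormal_basis E"
begin

lemma finite_E [simp, intro]: "finite E"
  using basis by (simp add: orthonormal_basis_def)

lemma inner_E: "a \<in> E \<Longrightarrow> b \<in> E \<Longrightarrow> a \<bullet> b = (if a = b then 1 else 0)"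
  using basis unfolding orthonormal_basis_def pairwise_def orthogonal_def
  by (metis norm_eq_1)

text \<open>Linear combinations of the basis vectors satisfy the identity, and they exhaust the space.\<close>

lemma expansion: "v = (\<Sum>e\<in>E. (v \<bullet> e) *\<^sub>R e)"
proof -
  have "v \<in> span E" using basis by (simp add: orthonormal_basis_def)
  then show ?thesis
  proof (induction rule: span_induct_alt)
    case base
    show ?case by simp
  next
    case (step c x y)
    have "(\<Sum>e\<in>E. (x \<bullet> e) *\<^sub>R e) = x"
      using step(1) by (simp add: inner_E if_distrib[of "\<lambda>t. t *\<^sub>R _"] cong: if_cong sum.cong)
    then have "(\<Sum>e\<in>E. ((c *\<^sub>R x + y) \<bullet> e) *\<^sub>R e) = c *\<^sub>R x + (\<Sum>e\<in>E. (y \<bullet> e) *\<^sub>R e)"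
      by (simp add: inner_add_left scaleR_add_left sum.distrib flip: scaleR_sum_right scaleR_scaleR)
    then show ?case using step(2) by simp
  qed
qed

lemma parseval: "v \<bullet> w = (\<Sum>e\<in>E. (v \<bullet> e) * (w \<bullet> e))"
proof -
  have "v \<bullet> w = v \<bullet> (\<Sum>e\<in>E. (w \<bullet> e) *\<^sub>R e)" using expansion[of w] by simp
  then show ?thesis by (simp add: inner_sum_right mult.commute)
qed

lemma r_squared_inner: "r_squared E v = v \<bullet> v"
  by (simp add: r_squared_def parseval[of v v] power2_eq_square)

lemma linear_expansion:
  fixes L :: "'v \<Rightarrow> 'b::real_vector"
  assumes "linear L" shows "L v = (\<Sum>e\<in>E. (v \<bullet> e) *\<^sub>R L e)"
proof -
  have "L v = L (\<Sum>e\<in>E. (v \<bullet> e) *\<^sub>R e)" using expansion[of v] by simp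
  then show ?thesis using assms by (simp add: linear_sum linear_cmul)
qed

text \<open>The type need not be a Euclidean space, so compactness is derived from the basis: the unit ball is
closed and lies in the parallelepiped of all combinations of basis vectors with coefficients in
\<open>[-1, 1]\<close>, a finite sum of compact segments.\<close>

lemma compact_sphere: "compact {v::'v. norm v = 1}"
  and compact_cball: "compact (cball (0::'v) 1)"
proof -
  have box: "compact {\<Sum>e\<in>F. x e *\<^sub>R e | x. \<forall>e\<in>F. \<bar>x e\<bar> \<le> (1::real)}" if "finite F" for F :: "'v set"
    using that
  proof (induction rule: finite_induct)
    case empty
    then show ?case by simp
  next
    case (insert a F)
    let ?B = "\<lambda>F. {\<Sum>e\<in>F. x e *\<^sub>R e | x. \<forall>e\<in>F. \<bar>x e\<bar> \<le> (1::real)}"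
    have "compact ((\<lambda>t::real. t *\<^sub>R a) ` {-1..1})"
      by (intro compact_continuous_image continuous_intros compact_Icc)
    then have "compact {u + w | u w. u \<in> (\<lambda>t::real. t *\<^sub>R a) ` {-1..1} \<and> w \<in> ?B F}"
      using insert.IH by (rule compact_sums)
    moreover have "{u + w | u w. u \<in> (\<lambda>t::real. t *\<^sub>R a) ` {-1..1} \<and> w \<in> ?B F} = ?B (insert a F)"
      (is "?L = ?R")
    proof (rule equalityI; rule subsetI)
      fix z assume "z \<in> ?L"
      then obtain t x where "z = t *\<^sub>R a + (\<Sum>e\<in>F. x e *\<^sub>R e)" "\<bar>t\<bar> \<le> 1" "\<forall>e\<in>F. \<bar>x e\<bar> \<le> 1"
        by (auto simp: abs_le_iff)
      moreover have "(\<Sum>e\<in>F. (x(a := t)) e *\<^sub>R e) = (\<Sum>e\<in>F. x e *\<^sub>R e)"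
        using insert.hyps by (intro sum.cong) auto
      ultimately show "z \<in> ?R" using insert.hyps
        by (intro CollectI exI[of _ "x(a := t)"]) auto
    next
      fix z assume "z \<in> ?R"
      then obtain x where "z = (\<Sum>e\<in>insert a F. x e *\<^sub>R e)" "\<forall>e\<in>insert a F. \<bar>x e\<bar> \<le> 1" by blast
      then show "z \<in> ?L" using insert.hyps
        by (intro CollectI exI[of _ "x a *\<^sub>R a"] exI[of _ "\<Sum>e\<in>F. x e *\<^sub>R e"]) (auto simp: abs_le_iff)
    qed
    ultimately show ?case by simp
  qed
  have "\<bar>v \<bullet> e\<bar> \<le> 1" if "v \<in> cball 0 1" "e \<in> E" for v e
    using that Cauchy_Schwarz_ineq2[of v e] basis unfolding orthonormal_basis_def by auto
  then have sub: "cball (0::'v) 1 \<subseteq> {\<Sum>e\<in>E. x e *\<^sub>R e | x. \<forall>e\<in>E. \<bar>x e\<bar> \<le> 1}"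
    using expansion by blast
  show cb: "compact (cball (0::'v) 1)"
    using compact_Int_closed[OF box[OF finite_E] closed_cball[of "0::'v" 1]] sub
    by (simp add: Int_absorb1)
  have "closed {v::'v. norm v = 1}"
    by (intro closed_Collect_eq continuous_intros)
  moreover have "{v::'v. norm v = 1} = cball 0 1 \<inter> {v. norm v = 1}" by auto
  ultimately show "compact {v::'v. norm v = 1}"
    using compact_Int_closed[OF cb] by metis
qed

end


section \<open>Homogeneous polynomials and the Laplacian\<close>

text \<open>The scaling identity is required for every real \<open>t\<close>, zero included, so that degree \<open>0\<close> means
constant and positive degree implies vanishing at the origin.\<close>

definition homogeneous :: "nat \<Rightarrow> ('v::real_inner \<Rightarrow> real) \<Rightarrow> bool" where
  "homogeneous d f \<longleftrightarrow> polyfun f \<and> (\<forall>t v. f (t *\<^sub>R v) = t ^ d * f v)"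

lemma homogeneous_polyfun: "homogeneous d f \<Longrightarrow> polyfun f"
  by (simp add: homogeneous_def)

lemma homogeneous_zero: "homogeneous d (\<lambda>v. 0)"
  by (simp add: homogeneous_def polyfun_const)

lemma homogeneous_add: "homogeneous d f \<Longrightarrow> homogeneous d g \<Longrightarrow> homogeneous d (\<lambda>v. f v + g v)"
  by (simp add: homogeneous_def polyfun_add algebra_simps)

lemma homogeneous_mult: "homogeneous i f \<Longrightarrow> homogeneous j g \<Longrightarrow> homogeneous (i + j) (\<lambda>v. f v * g v)"
  by (simp add: homogeneous_def polyfun_mult algebra_simps power_add)

lemma homogeneous_const: "homogeneous 0 (\<lambda>v. c)"
  by (simp add: homogeneous_def polyfun_const)

lemma homogeneous_cmult: "homogeneous d f \<Longrightarrow> homogeneous d (\<lambda>v. c * f v)"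
  using homogeneous_mult[OF homogeneous_const] by fastforce

lemma homogeneous_power: "homogeneous j f \<Longrightarrow> homogeneous (k * j) (\<lambda>v. f v ^ k)"
proof (induction k)
  case 0
  then show ?case by (simp add: homogeneous_const)
next
  case (Suc k)
  then show ?case using homogeneous_mult[of j f "k * j" "\<lambda>v. f v ^ k"] by simp
qed

lemma homogeneous_sum:
  "(\<And>i. i \<in> I \<Longrightarrow> homogeneous d (f i)) \<Longrightarrow> homogeneous d (\<lambda>v. \<Sum>i\<in>I. f i v)"
  by (induction I rule: infinite_finite_induct) (auto intro: homogeneous_zero homogeneous_add)

lemma homogeneous_0_const: "homogeneous 0 f \<Longrightarrow> f = (\<lambda>v. f 0)"
  unfolding homogeneous_def by (metis power_0 mult_1 scaleR_zero_left)

lemma homogeneous_at_0: "homogeneous d f \<Longrightarrow> 0 < d \<Longrightarrow> f 0 = 0"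
  unfolding homogeneous_def by (metis scaleR_zero_left mult_zero_left zero_power)

text \<open>Differentiating \<open>f (t v) = t\<^sup>d\<^sup>+\<^sup>1 f v\<close> with respect to \<open>v\<close> gives the claim multiplied by \<open>t\<close>.\<close>

lemma homogeneous_partial_deriv:
  assumes "homogeneous (Suc d) f"
  shows "homogeneous d (partial_deriv e f)"
  unfolding homogeneous_def
proof (intro conjI allI)
  have f: "polyfun f" using assms by (rule homogeneous_polyfun)
  show pd: "polyfun (partial_deriv e f)" using f by (rule polyfun_partial_deriv)
  fix t :: real and v :: 'a
  have scaled: "partial_deriv e f (t *\<^sub>R v) = t ^ d * partial_deriv e f v" if "t \<noteq> 0" for t
  proof -
    obtain D where D: "(f has_derivative D) (at (t *\<^sub>R v))" using polyfun_frechet[OF f] .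
    have "((\<lambda>v. f (t *\<^sub>R v)) has_derivative (\<lambda>u. D (t *\<^sub>R u))) (at v)"
      by (rule has_derivative_compose[where f="\<lambda>v. t *\<^sub>R v" and g=f])
         (auto intro!: derivative_eq_intros D)
    then have "partial_deriv e (\<lambda>v. f (t *\<^sub>R v)) v = D (t *\<^sub>R e)" by (rule partial_deriv_frechet)
    also have "\<dots> = t * partial_deriv e f (t *\<^sub>R v)"
      using partial_deriv_frechet[OF D] has_derivative_bounded_linear[OF D] by (simp add: linear_simps)
    also have "(\<lambda>v. f (t *\<^sub>R v)) = (\<lambda>v. t ^ Suc d * f v)"
      using assms by (simp add: homogeneous_def)
    finally show ?thesis
      using that by (simp add: partial_deriv_cmult[OF f] del: power_Suc) simp
  qed
  \<comment> \<open>The value \<open>t = 0\<close> is reached by continuity.\<close>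
  have "isCont (\<lambda>t. partial_deriv e f (t *\<^sub>R v)) 0"
    using continuous_on_polyfun[OF pd, of UNIV]
    by (intro continuous_within_compose3[where g="partial_deriv e f" and f="\<lambda>t. t *\<^sub>R v"] continuous_intros)
       (auto simp: continuous_on_eq_continuous_at)
  then have "((\<lambda>t. partial_deriv e f (t *\<^sub>R v)) \<longlongrightarrow> partial_deriv e f (0 *\<^sub>R v)) (at 0)"
    unfolding isCont_def .
  then have "((\<lambda>t. t ^ d * partial_deriv e f v) \<longlongrightarrow> partial_deriv e f (0 *\<^sub>R v)) (at 0)"
    by (rule Lim_transform_eventually) (auto simp: eventually_at_filter scaled)
  moreover have "((\<lambda>t::real. t ^ d * partial_deriv e f v) \<longlongrightarrow> 0 ^ d * partial_deriv e f v) (at 0)"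
    by (intro tendsto_intros)
  ultimately have "partial_deriv e f (0 *\<^sub>R v) = 0 ^ d * partial_deriv e f v"
    by (rule LIM_unique)
  then show "partial_deriv e f (t *\<^sub>R v) = t ^ d * partial_deriv e f v"
    using scaled by (cases "t = 0") auto
qed

text \<open>The restriction of \<open>f\<close> to the line through \<open>v\<close> in direction \<open>v\<close> is \<open>(1 + t)\<^sup>d f v\<close>.\<close>

lemma homogeneous_partial_deriv_direction:
  assumes "homogeneous d f"
  shows "partial_deriv v f v = d * f v"
proof -
  have "f (v + t *\<^sub>R v) = (1 + t) ^ d * f v" for t
    using assms unfolding homogeneous_def by (metis scaleR_add_left scaleR_one)
  then have "partial_deriv v f v = deriv (\<lambda>t. (1 + t) ^ d * f v) 0"
    by (simp add: partial_deriv_def)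
  also have "\<dots> = d * f v"
    by (rule DERIV_imp_deriv) (auto intro!: derivative_eq_intros)
  finally show ?thesis .
qed

context orthonormal_coordinates
begin

abbreviation lap :: "('v \<Rightarrow> real) \<Rightarrow> 'v \<Rightarrow> real" where "lap \<equiv> laplacian E"
abbreviation r2 :: "'v \<Rightarrow> real" where "r2 \<equiv> r_squared E"

lemma polyfun_lap: "polyfun f \<Longrightarrow> polyfun (lap f)"
  unfolding laplacian_def by (intro real_polynomial_function_sum finite_E polyfun_partial_deriv)

lemma polyfun_grad: "polyfun f \<Longrightarrow> polyfun g \<Longrightarrow> polyfun (grad_inner E f g)"
  unfolding grad_inner_def
  by (intro real_polynomial_function_sum finite_E polyfun_mult polyfun_partial_deriv)

lemma lap_fun: "lap f = (\<lambda>v. \<Sum>e\<in>E. partial_deriv e (partial_deriv e f) v)"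
  and grad_fun: "grad_inner E f g = (\<lambda>v. \<Sum>e\<in>E. partial_deriv e f v * partial_deriv e g v)"
  by (simp_all add: laplacian_def grad_inner_def fun_eq_iff)

lemma lap_zero: "lap (\<lambda>v. 0) = (\<lambda>v. 0)"
  by (simp add: lap_fun partial_deriv_const)

lemma lap_add:
  "polyfun f \<Longrightarrow> polyfun g \<Longrightarrow> lap (\<lambda>v. f v + g v) = (\<lambda>v. lap f v + lap g v)"
  by (simp add: lap_fun partial_deriv_add polyfun_partial_deriv sum.distrib)

lemma lap_cmult: "polyfun f \<Longrightarrow> lap (\<lambda>v. c * f v) = (\<lambda>v. c * lap f v)"
  by (simp add: lap_fun partial_deriv_cmult polyfun_partial_deriv sum_distrib_left)

lemma lap_mult:
  assumes f: "polyfun f" and g: "polyfun g"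
  shows "lap (\<lambda>v. f v * g v) = (\<lambda>v. f v * lap g v + lap f v * g v + 2 * grad_inner E f g v)"
proof -
  have "partial_deriv e (partial_deriv e (\<lambda>v. f v * g v)) v =
      f v * partial_deriv e (partial_deriv e g) v + partial_deriv e (partial_deriv e f) v * g v
      + 2 * (partial_deriv e f v * partial_deriv e g v)" for e v
    by (simp add: partial_deriv_mult partial_deriv_add polyfun_partial_deriv polyfun_mult f g)
  then show ?thesis
    by (simp add: laplacian_def grad_inner_def sum.distrib fun_eq_iff
        sum_distrib_left sum_distrib_right)
qed

lemma lap_sum:
  assumes "finite I" "\<And>i. i \<in> I \<Longrightarrow> polyfun (f i)"
  shows "lap (\<lambda>v. \<Sum>i\<in>I. f i v) = (\<lambda>v. \<Sum>i\<in>I. lap (f i) v)"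
  using assms
proof (induction rule: finite_induct)
  case empty
  then show ?case by (simp add: lap_zero)
next
  case (insert i I)
  have "polyfun (\<lambda>v. \<Sum>i\<in>I. f i v)" using insert by (simp add: real_polynomial_function_sum)
  then show ?case using insert by (simp add: lap_add)
qed

lemma lap_partial_deriv:
  assumes "polyfun f" shows "lap (partial_deriv a f) = partial_deriv a (lap f)"
proof -
  have "partial_deriv a (lap f) = (\<lambda>v. \<Sum>e\<in>E. partial_deriv a (partial_deriv e (partial_deriv e f)) v)"
    unfolding lap_fun
    by (intro partial_deriv_sum) (auto intro: polyfun_partial_deriv assms)
  then show ?thesis
    by (simp add: lap_fun polyfun_partial_deriv assms partial_deriv_commute[of "partial_deriv _ f" a]
        partial_deriv_commute[of f a])
qed

lemma grad_commute: "grad_inner E f g = grad_inner E g f"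
  by (simp add: grad_fun mult.commute)

lemma grad_add_right:
  "polyfun g \<Longrightarrow> polyfun h \<Longrightarrow>
   grad_inner E f (\<lambda>v. g v + h v) = (\<lambda>v. grad_inner E f g v + grad_inner E f h v)"
  by (simp add: grad_fun partial_deriv_add sum.distrib algebra_simps)

lemma grad_mult_right:
  "polyfun g \<Longrightarrow> polyfun h \<Longrightarrow>
   grad_inner E f (\<lambda>v. g v * h v) = (\<lambda>v. g v * grad_inner E f h v + grad_inner E f g v * h v)"
  by (simp add: grad_fun partial_deriv_mult sum.distrib sum_distrib_left sum_distrib_right
      algebra_simps)

lemma grad_const_right: "grad_inner E f (\<lambda>v. c) = (\<lambda>v. 0)"
  by (simp add: grad_fun partial_deriv_const)

lemma homogeneous_lap: "homogeneous (d + 2) f \<Longrightarrow> homogeneous d (lap f)"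
  unfolding lap_fun
  by (intro homogeneous_sum homogeneous_partial_deriv) (simp add: numeral_2_eq_2)

lemma lap_low_degree:
  assumes "homogeneous d f" "d < 2" shows "lap f = (\<lambda>v. 0)"
proof -
  have deg0: "partial_deriv e g = (\<lambda>v. 0)" if "homogeneous 0 g" for e and g :: "'v \<Rightarrow> real"
    using homogeneous_0_const[OF that] partial_deriv_const by metis
  have "partial_deriv e (partial_deriv e f) = (\<lambda>v. 0)" for e
  proof (cases d)
    case 0
    then have "partial_deriv e f = (\<lambda>v. 0)" using assms(1) by (intro deg0) simp
    then show ?thesis by (simp add: partial_deriv_const)
  next
    case (Suc i)
    then have "homogeneous 0 (partial_deriv e f)" using assms homogeneous_partial_deriv by auto
    then show ?thesis by (rule deg0)
  qed
  then show ?thesis by (simp add: lap_fun)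
qed

lemma homogeneous_lap_power:
  assumes "homogeneous m f"
  shows "if 2 * k \<le> m then homogeneous (m - 2 * k) ((lap ^^ k) f) else (lap ^^ k) f = (\<lambda>v. 0)"
proof (induction k)
  case 0
  then show ?case using assms by simp
next
  case (Suc k)
  show ?case
  proof (cases "2 * k \<le> m")
    case True
    with Suc have h: "homogeneous (m - 2 * k) ((lap ^^ k) f)" by simp
    show ?thesis
    proof (cases "m - 2 * k < 2")
      case True
      then show ?thesis using lap_low_degree[OF h] by auto
    next
      case False
      then have "m - 2 * k = (m - 2 * Suc k) + 2" by simp
      with h have "homogeneous (m - 2 * Suc k) (lap ((lap ^^ k) f))" by (metis homogeneous_lap)
      moreover have "2 * Suc k \<le> m" using False by simp
      ultimately show ?thesis by simp
    qed
  next
    case False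
    with Suc show ?thesis by (simp add: lap_zero)
  qed
qed

lemma euler:
  assumes "homogeneous d f"
  shows "(\<Sum>e\<in>E. (v \<bullet> e) * partial_deriv e f v) = d * f v"
  using linear_expansion[OF partial_deriv_direction_linear[OF homogeneous_polyfun[OF assms]], of v v]
    homogeneous_partial_deriv_direction[OF assms, of v] by simp

lemma homogeneous_r2: "homogeneous 2 r2"
proof -
  have "polyfun r2" unfolding r_squared_def
    by (intro real_polynomial_function_sum real_polynomial_function_power finite_E polyfun_inner)
  then show ?thesis by (simp add: homogeneous_def r_squared_inner power2_eq_square)
qed

lemmas polyfun_r2 = homogeneous_polyfun[OF homogeneous_r2]

lemma partial_deriv_r2: "partial_deriv e r2 = (\<lambda>v. 2 * (v \<bullet> e))"
proof
  fix v
  have "(r2 has_derivative (\<lambda>u. 2 * (v \<bullet> u))) (at v)"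
    unfolding r_squared_inner[abs_def] by (auto intro!: derivative_eq_intros simp: inner_commute)
  then show "partial_deriv e r2 v = 2 * (v \<bullet> e)" by (rule partial_deriv_frechet)
qed

text \<open>Pairing with the gradient of \<open>r\<^sup>2\<close> is twice the Euler operator; its eigenspaces are the homogeneous
components.\<close>

lemma grad_r2: "homogeneous d f \<Longrightarrow> grad_inner E r2 f = (\<lambda>v. 2 * d * f v)"
  using euler[of d f]
  by (simp add: grad_fun partial_deriv_r2 mult.assoc fun_eq_iff flip: sum_distrib_left)

lemma lap_r2: "lap r2 = (\<lambda>v. 2 * card E)"
proof -
  have "partial_deriv e (partial_deriv e r2) v = 2" if "e \<in> E" for e v
    using that inner_E[of e e] partial_deriv_cmult[OF polyfun_inner, of e 2 e]
    by (simp add: partial_deriv_r2 partial_deriv_linear bounded_linear_inner_left)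
  then show ?thesis by (simp add: lap_fun mult.commute)
qed

lemma lap_r2_mult:
  fixes g :: "'v \<Rightarrow> real"
  assumes "homogeneous m g"
  shows "lap (\<lambda>v. r2 v * g v) = (\<lambda>v. r2 v * lap g v + real (2 * card E + 4 * m) * g v)"
  unfolding lap_mult[OF polyfun_r2 homogeneous_polyfun[OF assms]] grad_r2[OF assms] lap_r2
  by (simp add: algebra_simps)

lemma homogeneous_r2_power_mult:
  "homogeneous j h \<Longrightarrow> homogeneous (2 * k + j) (\<lambda>v. r2 v ^ k * h v)"
  using homogeneous_mult[OF homogeneous_power[OF homogeneous_r2]] by (simp add: mult.commute)

text \<open>Repeated use of \<open>lap_r2_mult\<close>: the contributions \<open>2n + 4m\<close>, with \<open>n\<close> the dimension and \<open>m\<close> running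
over the degrees \<open>j, j + 2, \<dots>\<close> of the successive powers, add up to \<open>2k (n + 2 (k - 1) + 2j)\<close>. At
\<open>k = 0\<close> the factor \<open>2k\<close> absorbs the truncated subtraction.\<close>

lemma lap_r2_power_harmonic:
  fixes h :: "'v \<Rightarrow> real"
  assumes "homogeneous j h" "lap h = (\<lambda>v. 0)"
  shows "lap (\<lambda>v. r2 v ^ k * h v) =
    (\<lambda>v. real (2 * k * (card E + 2 * (k - 1) + 2 * j)) * (r2 v ^ (k - 1) * h v))"
proof (induction k)
  case 0
  then show ?case using assms by simp
next
  case (Suc k)
  have "lap (\<lambda>v. r2 v ^ Suc k * h v) = lap (\<lambda>v. r2 v * (r2 v ^ k * h v))"
    by (simp add: mult.assoc)
  also have "\<dots> = (\<lambda>v. r2 v * lap (\<lambda>v. r2 v ^ k * h v) v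
      + real (2 * card E + 4 * (2 * k + j)) * (r2 v ^ k * h v))"
    using lap_r2_mult[OF homogeneous_r2_power_mult[OF assms(1), of k]] by simp
  also have "\<dots> = (\<lambda>v. real (2 * Suc k * (card E + 2 * k + 2 * j)) * (r2 v ^ k * h v))"
    unfolding Suc.IH using assms(2) by (cases k) (simp_all add: algebra_simps)
  finally show ?case by simp
qed

text \<open>The eigenvalue in \<open>\<Delta>\<^sup>i (r\<^sup>2\<^sup>k h) = lap_coeff j k i \<cdot> r\<^sup>2\<^sup>(\<^sup>k\<^sup>-\<^sup>i\<^sup>) h\<close> for \<open>h\<close> harmonic of degree \<open>j\<close>.
For \<open>i > k\<close> the factor \<open>l = k\<close> makes the product zero, as it should be.\<close>

definition lap_coeff :: "nat \<Rightarrow> nat \<Rightarrow> nat \<Rightarrow> real" where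
  "lap_coeff j k i = (\<Prod>l<i. real (2 * (k - l) * (card E + 2 * (k - l - 1) + 2 * j)))"

lemma lap_power_r2_power_harmonic:
  fixes h :: "'v \<Rightarrow> real"
  assumes "homogeneous j h" "lap h = (\<lambda>v. 0)"
  shows "(lap ^^ i) (\<lambda>v. r2 v ^ k * h v) = (\<lambda>v. lap_coeff j k i * (r2 v ^ (k - i) * h v))"
proof (induction i)
  case 0
  then show ?case by (simp add: lap_coeff_def)
next
  case (Suc i)
  have "polyfun (\<lambda>v. r2 v ^ (k - i) * h v)"
    using homogeneous_r2_power_mult[OF assms(1)] by (rule homogeneous_polyfun)
  then show ?case
    by (simp add: Suc.IH lap_cmult lap_r2_power_harmonic[OF assms] lap_coeff_def mult.assoc)
qed

lemma lap_coeff_pos: 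
  assumes "E \<noteq> {}" shows "lap_coeff j k k > 0"
  unfolding lap_coeff_def
proof (intro prod_pos)
  fix l assume "l \<in> {..<k}"
  then have "0 < 2 * (k - l) * (card E + 2 * (k - l - 1) + 2 * j)"
    using assms by (simp add: card_gt_0_iff)
  then show "0 < real (2 * (k - l) * (card E + 2 * (k - l - 1) + 2 * j))"
    by (simp only: of_nat_0_less_iff)
qed

lemma lap_coeff_zero: "k < i \<Longrightarrow> lap_coeff j k i = 0"
  unfolding lap_coeff_def by (rule prod_zero) (auto intro!: bexI[of _ k])

lemma polyfun_lap_power: "polyfun f \<Longrightarrow> polyfun ((lap ^^ k) f)"
  by (induction k) (simp_all add: polyfun_lap)

lemma lap_power_add:
  "polyfun f \<Longrightarrow> polyfun g \<Longrightarrow>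
   (lap ^^ k) (\<lambda>v. f v + g v) = (\<lambda>v. (lap ^^ k) f v + (lap ^^ k) g v)"
  by (induction k) (simp_all add: lap_add polyfun_lap_power)

lemma lap_power_cmult: "polyfun f \<Longrightarrow> (lap ^^ k) (\<lambda>v. c * f v) = (\<lambda>v. c * (lap ^^ k) f v)"
  by (induction k) (simp_all add: lap_cmult polyfun_lap_power)

end


section \<open>Uniform approximation along the fibres of a subalgebra\<close>

text \<open>The Stone--Weierstrass theorem on the quotient of \<open>K\<close> by the relation of having equal values under all of \<open>R\<close>.
To have a Hausdorff space at hand, countably many members of \<open>R\<close> are chosen that already
separate the points on which \<open>h\<close> differs. They map \<open>K\<close> onto a compact set of real
sequences, through which \<open>h\<close> factors, and the classical theorem applies to that set.\<close>

lemma Stone_Weierstrass_fibres: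
  fixes K :: "'a::topological_space set" and R :: "('a \<Rightarrow> real) set"
  assumes K: "compact K"
    and R: "function_subalgebra R" "\<And>f. f \<in> R \<Longrightarrow> continuous_on UNIV f"
    and h: "continuous_on UNIV h"
    and sep: "\<And>x y. x \<in> K \<Longrightarrow> y \<in> K \<Longrightarrow> h x \<noteq> h y \<Longrightarrow> \<exists>f\<in>R. f x \<noteq> f y"
    and e: "0 < e"
  shows "\<exists>f\<in>R. \<forall>x\<in>K. \<bar>h x - f x\<bar> < e"
proof -
  have const: "(\<lambda>_. c) \<in> R" for c using R(1) by (simp add: function_subalgebra_def)
  \<comment> \<open>For each \<open>n\<close>, the pairs on which \<open>h\<close> differs by at least \<open>1 / (n + 1)\<close> form a compact set, which
    finitely many members of \<open>R\<close> suffice to separate.\<close>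
  have "\<exists>F\<subseteq>R. finite F \<and> (\<forall>x\<in>K. \<forall>y\<in>K. 1 / Suc n \<le> \<bar>h x - h y\<bar> \<longrightarrow> (\<exists>f\<in>F. f x \<noteq> f y))" for n
  proof -
    let ?D = "(K \<times> K) \<inter> {p. 1 / Suc n \<le> \<bar>h (fst p) - h (snd p)\<bar>}"
    let ?U = "\<lambda>f::'a \<Rightarrow> real. {p. f (fst p) \<noteq> f (snd p)}"
    have cont: "continuous_on UNIV (\<lambda>p. f (fst p))" "continuous_on UNIV (\<lambda>p. f (snd p))"
      if "continuous_on UNIV f" for f :: "'a \<Rightarrow> real"
      by (auto intro!: continuous_on_compose2[OF that] continuous_intros)
    have "closed {p. 1 / Suc n \<le> \<bar>h (fst p) - h (snd p)\<bar>}"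
      by (intro closed_Collect_le continuous_intros cont h)
    then have "compact ?D" using K by (intro compact_Int_closed compact_Times)
    moreover have "open (?U f)" if "f \<in> R" for f
      by (intro open_Collect_neq cont R(2) that)
    moreover have "?D \<subseteq> (\<Union>f\<in>R. ?U f)"
    proof
      fix p assume p: "p \<in> ?D"
      then have "0 < \<bar>h (fst p) - h (snd p)\<bar>"
        by (auto intro: less_le_trans[rotated])
      then show "p \<in> (\<Union>f\<in>R. ?U f)" using p sep[of "fst p" "snd p"] by auto
    qed
    ultimately obtain F where "F \<subseteq> R" "finite F" "?D \<subseteq> (\<Union>f\<in>F. ?U f)"
      by (rule compactE_image)
    then show ?thesis by (intro exI[of _ F]) fastforce
  qed
  then obtain F where F: "\<And>n. F n \<subseteq> R" "\<And>n. finite (F n)"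
    "\<And>n x y. x \<in> K \<Longrightarrow> y \<in> K \<Longrightarrow> 1 / Suc n \<le> \<bar>h x - h y\<bar> \<Longrightarrow> \<exists>f\<in>F n. f x \<noteq> f y"
    by metis
  \<comment> \<open>The constant function is added only to make the family nonempty.\<close>
  define C where "C = insert (\<lambda>_. 0) (\<Union>n. F n)"
  have C: "C \<noteq> {}" "countable C" "C \<subseteq> R"
    using F const by (auto simp: C_def countable_finite)
  define \<phi> where "\<phi> = from_nat_into C"
  have \<phi>: "range \<phi> = C" "\<And>n. \<phi> n \<in> R"
    using range_from_nat_into[OF C(1,2)] from_nat_into[OF C(1)] C(3) by (auto simp: \<phi>_def)
  define \<Phi> where "\<Phi> x = (\<lambda>n. \<phi> n x)" for x
  have cont_\<Phi>: "continuous_on A \<Phi>" for A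
    unfolding \<Phi>_def
    by (intro continuous_on_coordinatewise_then_product continuous_on_subset[OF R(2)] \<phi>) auto
  have fib: "h x = h y" if xy: "x \<in> K" "y \<in> K" "\<Phi> x = \<Phi> y" for x y
  proof (rule ccontr)
    assume "h x \<noteq> h y"
    then obtain n where "1 / Suc n \<le> \<bar>h x - h y\<bar>"
      using nat_approx_posE[of "\<bar>h x - h y\<bar>"] by (metis less_imp_le right_minus_eq zero_less_abs_iff)
    then obtain f where "f \<in> C" "f x \<noteq> f y" using F(3)[OF xy(1,2)] unfolding C_def by blast
    then obtain n where "\<phi> n x \<noteq> \<phi> n y" using \<phi>(1) by (metis imageE)
    then show False using xy(3) by (auto simp: \<Phi>_def fun_eq_iff)
  qed
  define H where "H z = h (SOME x. x \<in> K \<and> \<Phi> x = z)" for z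
  have H: "H (\<Phi> x) = h x" if "x \<in> K" for x
  proof -
    have "(SOME y. y \<in> K \<and> \<Phi> y = \<Phi> x) \<in> K \<and> \<Phi> (SOME y. y \<in> K \<and> \<Phi> y = \<Phi> x) = \<Phi> x"
      by (rule someI[of _ x]) (simp add: that)
    then show ?thesis unfolding H_def using fib that by blast
  qed
  have "continuous_on (\<Phi> ` K) H"
    unfolding continuous_on_closed_invariant
  proof (intro allI impI)
    fix B :: "real set" assume "closed B"
    then have "closed (h -` B)" using h by (simp add: continuous_on_closed_vimage)
    then have "compact (\<Phi> ` (K \<inter> h -` B))"
      using K by (intro compact_continuous_image cont_\<Phi> compact_Int_closed)
    then have "closed (\<Phi> ` (K \<inter> h -` B))" by (rule compact_imp_closed)
    moreover have "\<Phi> ` (K \<inter> h -` B) \<inter> \<Phi> ` K = H -` B \<inter> \<Phi> ` K" using H by auto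
    ultimately show "\<exists>A. closed A \<and> A \<inter> \<Phi> ` K = H -` B \<inter> \<Phi> ` K" by blast
  qed
  moreover have "function_ring_on {f. continuous_on (\<Phi> ` K) f \<and> (\<lambda>x. f (\<Phi> x)) \<in> R} (\<Phi> ` K)"
  proof
    show "compact (\<Phi> ` K)" using K cont_\<Phi> by (intro compact_continuous_image)
    fix z w assume "z \<in> \<Phi> ` K" "w \<in> \<Phi> ` K" "z \<noteq> w"
    then obtain n where "z n \<noteq> w n" by auto
    moreover have "continuous_on (\<Phi> ` K) (\<lambda>z. z n)"
      by (rule continuous_on_subset[OF continuous_on_product_coordinates]) simp
    moreover have "(\<lambda>x. \<Phi> x n) \<in> R" using \<phi>(2) by (simp add: \<Phi>_def)
    ultimately show "\<exists>f\<in>{f. continuous_on (\<Phi> ` K) f \<and> (\<lambda>x. f (\<Phi> x)) \<in> R}. f z \<noteq> f w"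
      by (intro bexI[of _ "\<lambda>z. z n"]) auto
  qed (use R(1) in \<open>auto simp: function_subalgebra_def intro!: continuous_intros\<close>)
  ultimately obtain g where "(\<lambda>x. g (\<Phi> x)) \<in> R" "\<forall>z\<in>\<Phi> ` K. \<bar>H z - g z\<bar> < e"
    using function_ring_on.Stone_Weierstrass_basic[OF _ _ e] by fastforce
  then show ?thesis using H by (intro bexI[of _ "\<lambda>x. g (\<Phi> x)"]) auto
qed

section \<open>Orthogonal projections\<close>

text \<open>Induction on the number of coordinates. If some \<open>w \<in> W\<close> has a nonzero coordinate \<open>j\<close>, then \<open>W\<close>
is the sum of its hyperplane \<open>q j = 0\<close>, on which the induction hypothesis gives projections, and
the line spanned by the part \<open>z\<close> of \<open>w\<close> orthogonal to that hyperplane.\<close>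

lemma orthogonal_projection_exists:
  fixes x :: "'i \<Rightarrow> real"
  assumes "finite I" "W \<noteq> {}"
    and "\<And>p q c. p \<in> W \<Longrightarrow> q \<in> W \<Longrightarrow> (\<lambda>i. p i + c * q i) \<in> W"
  shows "\<exists>p\<in>W. \<forall>q\<in>W. (\<Sum>i\<in>I. (x i - p i) * q i) = 0"
  using assms
proof (induction I arbitrary: W x rule: finite_induct)
  case empty
  then show ?case by auto
next
  case (insert j I W x)
  note W = insert.prems
  show ?case
  proof (cases "\<forall>q\<in>W. q j = 0")
    case True
    obtain p where "p \<in> W" "\<forall>q\<in>W. (\<Sum>i\<in>I. (x i - p i) * q i) = 0"
      using insert.IH[OF W, of x] by blast
    then show ?thesis using True insert.hyps by (intro bexI[of _ p]) auto
  next
    case False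
    then obtain w where w: "w \<in> W" "w j \<noteq> 0" by blast
    define W' where "W' = {q\<in>W. q j = 0}"
    \<comment> \<open>The zero vector, which shows that the hyperplane is nonempty.\<close>
    have "(\<lambda>i. w i + (-1) * w i) \<in> W'" using w W(2)[OF w(1) w(1), of "-1"] by (simp add: W'_def)
    then have W': "W' \<noteq> {}" "\<And>p q c. p \<in> W' \<Longrightarrow> q \<in> W' \<Longrightarrow> (\<lambda>i. p i + c * q i) \<in> W'"
      using W(2) by (auto simp: W'_def)
    obtain u where u: "u \<in> W'" "\<And>q. q \<in> W' \<Longrightarrow> (\<Sum>i\<in>I. (w i - u i) * q i) = 0"
      using insert.IH[OF W', of w] by blast
    obtain p where p: "p \<in> W'" "\<And>q. q \<in> W' \<Longrightarrow> (\<Sum>i\<in>I. (x i - p i) * q i) = 0"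
      using insert.IH[OF W', of x] by blast
    define z where "z i = w i - u i" for i
    have z: "z \<in> W" "z j \<noteq> 0"
      using W(2)[OF w(1), of u "-1"] u(1) w by (simp_all add: z_def[abs_def] W'_def)
    let ?S = "\<lambda>f g. \<Sum>i\<in>insert j I. f i * g i"
    have S: "?S f q = (\<Sum>i\<in>I. f i * q i)" if "q \<in> W'" for f q
      using that insert.hyps by (simp add: W'_def)
    have "0 < z j * z j" using z(2) by (auto simp: zero_less_mult_iff linorder_neq_iff)
    also have "\<dots> \<le> ?S z z" using insert.hyps by (simp add: sum_nonneg)
    finally have N: "?S z z \<noteq> 0" by simp
    define c where "c = ?S (\<lambda>i. x i - p i) z / ?S z z"
    show ?thesis
    proof (intro bexI ballI)
      show "(\<lambda>i. p i + c * z i) \<in> W" using W(2) p(1) z(1) by (simp add: W'_def)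
      fix q assume q: "q \<in> W"
      define a where "a = q j / z j"
      define r where "r i = q i + (- a) * z i" for i
      have r: "r \<in> W'" using W(2)[OF q z(1), of "-a"] z(2)
        by (simp add: W'_def r_def[abs_def] a_def)
      have q_eq: "q = (\<lambda>i. r i + a * z i)" by (simp add: r_def)
      have "?S (\<lambda>i. x i - (p i + c * z i)) q =
          (?S (\<lambda>i. x i - p i) r - c * ?S z r) + a * (?S (\<lambda>i. x i - p i) z - c * ?S z z)"
        unfolding q_eq sum_distrib_left sum_subtractf[symmetric] sum.distrib[symmetric]
        by (intro sum.cong) (auto simp: algebra_simps)
      also have "?S (\<lambda>i. x i - p i) r = 0" using p(2)[OF r] S[OF r] by metis
      also have "?S z r = 0" using u(2)[OF r] S[OF r] unfolding z_def by metis
      also have "?S (\<lambda>i. x i - p i) z - c * ?S z z = 0" using N by (simp add: c_def)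
      finally show "?S (\<lambda>i. x i - (p i + c * z i)) q = 0" by simp
    qed
  qed
qed

section \<open>The maximum principle\<close>

lemma second_partial_deriv_at_max:
  assumes u: "polyfun u" and e: "norm e = 1" and d: "0 < d"
    and max: "\<And>y. dist x y < d \<Longrightarrow> u y \<le> u x"
  shows "partial_deriv e (partial_deriv e u) x \<le> 0"
proof (rule ccontr)
  define g where "g t = u (x + t *\<^sub>R e)" for t
  \<comment> \<open>If the second derivative were positive, the first derivative, zero at \<open>x\<close>, would be positive
    just after \<open>x\<close>, and \<open>u\<close> would increase there.\<close>
  define g' where "g' t = partial_deriv e u (x + t *\<^sub>R e)" for t
  have g: "DERIV g t :> g' t" for t
    unfolding g_def g'_def by (rule partial_deriv_line[OF u])
  have g_max: "g t \<le> g 0" if "\<bar>t\<bar> < d" for t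
    using max[of "x + t *\<^sub>R e"] that e by (simp add: g_def dist_norm)
  have "g' 0 = 0"
    by (rule DERIV_local_max[OF g d]) (use g_max in auto)
  assume "\<not> ?thesis"
  moreover have "DERIV g' 0 :> partial_deriv e (partial_deriv e u) x"
    using partial_deriv_line[OF polyfun_partial_deriv[OF u], where v=x and e=e and s=0]
    by (simp add: g'_def[abs_def])
  ultimately have "\<exists>d>0. \<forall>h>0. h < d \<longrightarrow> g' 0 < g' (0 + h)"
    by (intro DERIV_pos_inc_right) auto
  then obtain d' where d': "0 < d'" "\<And>s. 0 < s \<Longrightarrow> s < d' \<Longrightarrow> g' 0 < g' s" by auto
  define s where "s = min d d' / 2"
  have s: "0 < s" "s < d" "s < d'" using d d'(1) by (auto simp: s_def)
  have "g 0 < g s"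
  proof (rule DERIV_pos_imp_increasing_open[OF s(1)])
    fix t assume "0 < t" "t < s"
    then show "\<exists>y. DERIV g t :> y \<and> 0 < y" using g d'(2)[of t] s \<open>g' 0 = 0\<close> by auto
  next
    show "continuous_on {0..s} g" by (rule DERIV_continuous_on, rule has_field_derivative_at_within, rule g)
  qed
  then show False using g_max[of s] s by simp
qed

context orthonormal_coordinates
begin

text \<open>Adding a small multiple of \<open>r\<^sup>2\<close> makes the Laplacian strictly positive while the value at the
centre still exceeds the values on the sphere. The maximum over the ball is then attained in the
interior, where all second derivatives are nonpositive.\<close>

lemma harmonic_center_le_sphere:
  assumes H: "polyfun H" "lap H = (\<lambda>v. 0)" and E: "E \<noteq> {}"
    and bound: "\<And>v. norm v = 1 \<Longrightarrow> H v \<le> M"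
  shows "H 0 \<le> M"
proof (rule ccontr)
  assume "\<not> ?thesis"
  then have M: "M < H 0" by simp
  \<comment> \<open>On the sphere \<open>H + c r\<^sup>2 \<le> M + c\<close>, which stays below \<open>H 0\<close>.\<close>
  define c where "c = (H 0 - M) / 2"
  have c: "0 < c" using M by (simp add: c_def)
  define u where "u v = H v + c * r2 v" for v
  have poly: "polyfun (\<lambda>v. c * r2 v)" by (intro polyfun_mult polyfun_const polyfun_r2)
  have u: "polyfun u" unfolding u_def by (intro polyfun_add H(1) poly)
  have "lap u = (\<lambda>v. c * (2 * card E))"
    unfolding u_def using lap_add[OF H(1) poly] lap_cmult[OF polyfun_r2, of c] by (simp add: H(2) lap_r2)
  then have lap_u: "0 < lap u v" for v using c E by (simp add: card_gt_0_iff)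
  obtain x where x: "x \<in> cball 0 1" "\<And>y. y \<in> cball 0 1 \<Longrightarrow> u y \<le> u x"
    using continuous_attains_sup[OF compact_cball, of u] continuous_on_polyfun[OF u] by auto
  have "norm x \<noteq> 1"
  proof
    assume "norm x = 1"
    then have "u x \<le> M + c"
      using bound[of x] by (simp add: u_def r_squared_inner power2_norm_eq_inner[symmetric])
    moreover have "u x \<ge> H 0" using x(2)[of 0] by (simp add: u_def r_squared_inner)
    ultimately show False using M by (simp add: c_def field_simps)
  qed
  then have "0 < 1 - norm x" using x(1) by simp
  moreover have "u y \<le> u x" if "dist x y < 1 - norm x" for y
    using that norm_triangle_ineq[of "y - x" x] by (intro x(2)) (simp add: dist_norm norm_minus_commute)
  ultimately have "partial_deriv e (partial_deriv e u) x \<le> 0" if "e \<in> E" for e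
    using that basis by (intro second_partial_deriv_at_max[OF u, of _ "1 - norm x"]) (auto simp: orthonormal_basis_def)
  then have "lap u x \<le> 0" unfolding laplacian_def by (intro sum_nonpos)
  then show False using lap_u[of x] by simp
qed

end


section \<open>The mean value functional\<close>

text \<open>The first letter of the word is the first direction of differentiation. Partial derivatives of polynomials
commute, so the order affects no value; this one matches the recursion in
\<open>lap_power_mult_harmonic\<close>.\<close>

definition iter_deriv :: "'v::real_inner list \<Rightarrow> ('v \<Rightarrow> real) \<Rightarrow> 'v \<Rightarrow> real" where
  "iter_deriv w f = fold partial_deriv w f"

lemma iter_deriv_simps [simp]:
  "iter_deriv [] f = f" "iter_deriv (e # w) f = iter_deriv w (partial_deriv e f)"
  by (simp_all add: iter_deriv_def)

lemma iter_deriv_zero: "iter_deriv w (\<lambda>v. 0) = (\<lambda>v. 0)"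
  by (induction w) (simp_all add: partial_deriv_const)

lemma iter_deriv_lincomb:
  "polyfun f \<Longrightarrow> polyfun g \<Longrightarrow>
   iter_deriv w (\<lambda>v. f v + c * g v) = (\<lambda>v. iter_deriv w f v + c * iter_deriv w g v)"
proof (induction w arbitrary: f g)
  case Nil
  then show ?case by simp
next
  case (Cons e w)
  have "polyfun (\<lambda>v. c * g v)" using Cons.prems by (intro polyfun_mult polyfun_const)
  then show ?case using Cons by (simp add: partial_deriv_add partial_deriv_cmult polyfun_partial_deriv)
qed

lemma iter_deriv_high_order:
  assumes "homogeneous d f" "d < length w"
  shows "iter_deriv w f = (\<lambda>v. 0)"
  using assms
proof (induction w arbitrary: d f)
  case Nil
  then show ?case by simp
next
  case (Cons e w)
  show ?case
  proof (cases d)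
    case 0
    then have "f = (\<lambda>v. f 0)" using Cons.prems homogeneous_0_const by blast
    then have "partial_deriv e f = (\<lambda>v. 0)" using partial_deriv_const by metis
    then show ?thesis by (simp add: iter_deriv_zero)
  next
    case (Suc i)
    then have "homogeneous i (partial_deriv e f)" using Cons.prems homogeneous_partial_deriv by blast
    then show ?thesis using Cons.IH Cons.prems Suc by simp
  qed
qed

context orthonormal_coordinates
begin

definition words :: "nat \<Rightarrow> 'v list set" where
  "words k = {w. set w \<subseteq> E \<and> length w = k}"

lemma finite_words: "finite (words k)"
  unfolding words_def by (rule finite_lists_length_eq[OF finite_E])

lemma words_0: "words 0 = {[]}"
  by (auto simp: words_def)

lemma sum_words_Suc: "(\<Sum>w\<in>words (Suc k). F w) = (\<Sum>e\<in>E. \<Sum>w\<in>words k. F (e # w))"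
proof -
  have "words (Suc k) = (\<lambda>(e, w). e # w) ` (E \<times> words k)"
    unfolding words_def by (force simp: length_Suc_conv image_iff)
  moreover have "inj_on (\<lambda>(e, w). e # w) (E \<times> words k)" by (auto simp: inj_on_def)
  ultimately have "(\<Sum>w\<in>words (Suc k). F w) = (\<Sum>x\<in>E \<times> words k. F (case x of (e, w) \<Rightarrow> e # w))"
    by (simp only: sum.reindex comp_def)
  then show ?thesis by (simp add: sum.cartesian_product case_prod_beta)
qed

lemma lap_power_sum:
  assumes "finite I" "\<And>i. i \<in> I \<Longrightarrow> polyfun (f i)"
  shows "(lap ^^ k) (\<lambda>v. \<Sum>i\<in>I. f i v) = (\<lambda>v. \<Sum>i\<in>I. (lap ^^ k) (f i) v)"
  by (induction k) (simp_all add: lap_sum assms polyfun_lap_power)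

text \<open>For harmonic factors the product rule reduces to \<open>\<Delta> (p q) = 2 \<Sum>\<^sub>e \<partial>\<^sub>e p \<partial>\<^sub>e q\<close>, and the factors on
the right are again harmonic.\<close>

lemma lap_power_mult_harmonic:
  assumes "polyfun p" "polyfun q" "lap p = (\<lambda>v. 0)" "lap q = (\<lambda>v. 0)"
  shows "(lap ^^ k) (\<lambda>v. p v * q v) = (\<lambda>v. 2 ^ k * (\<Sum>w\<in>words k. iter_deriv w p v * iter_deriv w q v))"
  using assms
proof (induction k arbitrary: p q)
  case 0
  then show ?case by (simp add: words_0)
next
  case (Suc k)
  let ?d = "\<lambda>e v. partial_deriv e p v * partial_deriv e q v"
  have poly: "polyfun (?d e)" for e
    using Suc.prems by (intro polyfun_mult polyfun_partial_deriv)
  have "lap (\<lambda>v. p v * q v) = (\<lambda>v. 2 * (\<Sum>e\<in>E. ?d e v))"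
    using Suc.prems by (simp add: lap_mult grad_inner_def)
  then have "(lap ^^ Suc k) (\<lambda>v. p v * q v) = (lap ^^ k) (\<lambda>v. 2 * (\<Sum>e\<in>E. ?d e v))"
    by (simp add: funpow_swap1)
  also have "\<dots> = (\<lambda>v. 2 * (\<Sum>e\<in>E. (lap ^^ k) (?d e) v))"
    by (simp add: lap_power_cmult lap_power_sum poly real_polynomial_function_sum)
  also have "\<dots> = (\<lambda>v. 2 * (\<Sum>e\<in>E. 2 ^ k *
      (\<Sum>w\<in>words k. iter_deriv w (partial_deriv e p) v * iter_deriv w (partial_deriv e q) v)))"
    using Suc.prems
    by (subst Suc.IH) (simp_all add: lap_partial_deriv polyfun_partial_deriv partial_deriv_const)
  finally show ?case
    by (simp add: sum_words_Suc sum_distrib_left mult.assoc)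
qed

lemma lap_power_at_0:
  assumes "homogeneous m f" "2 * k \<noteq> m"
  shows "(lap ^^ k) f 0 = 0"
  using homogeneous_lap_power[OF assms(1), of k] assms(2)
  by (auto split: if_splits intro: homogeneous_at_0)

text \<open>On homogeneous polynomials of degree \<open>d\<close> this is, up to a factor, the Fischer inner product
\<open>p(\<partial>) q\<close>, written as an inner product of coordinate vectors.\<close>

definition fischer :: "nat \<Rightarrow> ('v \<Rightarrow> real) \<Rightarrow> ('v \<Rightarrow> real) \<Rightarrow> real" where
  "fischer d p q = (\<Sum>w\<in>words d. iter_deriv w p 0 * iter_deriv w q 0)"

text \<open>The product has degree \<open>i + j\<close>, so only \<open>2 k = i + j\<close> leaves a nonzero value at the origin. If
\<open>i \<noteq> j\<close>, then \<open>k\<close> exceeds one of the two degrees, and all derivatives of order \<open>k\<close> of that factor vanish.\<close>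

lemma lap_power_mult_harmonic_at_0:
  assumes "homogeneous i p" "homogeneous j q" "lap p = (\<lambda>v. 0)" "lap q = (\<lambda>v. 0)"
  shows "(lap ^^ k) (\<lambda>v. p v * q v) 0 = (if i = k \<and> j = k then 2 ^ k * fischer k p q else 0)"
proof (cases "2 * k = i + j \<and> i \<noteq> j")
  case True
  then have "iter_deriv w p 0 * iter_deriv w q 0 = 0" if "w \<in> words k" for w
    using that iter_deriv_high_order[OF assms(1), of w] iter_deriv_high_order[OF assms(2), of w]
    by (cases "i < k") (auto simp: words_def)
  then have "(\<Sum>w\<in>words k. iter_deriv w p 0 * iter_deriv w q 0) = 0" by (intro sum.neutral ballI)
  then show ?thesis
    using True assms by (auto simp: lap_power_mult_harmonic homogeneous_polyfun)
next
  case False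
  show ?thesis
  proof (cases "i = k \<and> j = k")
    case True
    then show ?thesis
      using assms by (simp add: lap_power_mult_harmonic homogeneous_polyfun fischer_def)
  next
    case neq: False
    have "2 * k \<noteq> i + j" using False neq by auto
    then show ?thesis using neq lap_power_at_0[OF homogeneous_mult[OF assms(1,2)]] by simp
  qed
qed

text \<open>By induction all first derivatives vanish, and Euler's identity recovers \<open>f\<close> from them.\<close>

lemma iter_deriv_eq_0D:
  assumes "homogeneous d f" "\<And>w. w \<in> words d \<Longrightarrow> iter_deriv w f 0 = 0"
  shows "f = (\<lambda>v. 0)"
  using assms
proof (induction d arbitrary: f)
  case 0
  then have "f 0 = 0" by (simp add: words_0)
  then show ?case using homogeneous_0_const[OF 0(1)] by metis
next
  case (Suc d)
  have "partial_deriv e f = (\<lambda>v. 0)" if "e \<in> E" for e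
  proof (rule Suc.IH)
    show "homogeneous d (partial_deriv e f)" using Suc.prems(1) by (rule homogeneous_partial_deriv)
    fix w assume "w \<in> words d"
    then have "e # w \<in> words (Suc d)" using that by (simp add: words_def)
    then show "iter_deriv w (partial_deriv e f) 0 = 0" using Suc.prems(2) by fastforce
  qed
  then have "Suc d * f v = 0" for v using euler[OF Suc.prems(1), of v] by simp
  then show ?case by auto
qed

lemma fischer_definite:
  assumes "homogeneous d f" "fischer d f f = 0"
  shows "f = (\<lambda>v. 0)"
proof (rule iter_deriv_eq_0D[OF assms(1)])
  fix w assume "w \<in> words d"
  then show "iter_deriv w f 0 = 0"
    using assms(2) finite_words by (simp add: fischer_def sum_nonneg_eq_0_iff)
qed

lemma fischer_nonneg: "0 \<le> fischer d f f"
  by (simp add: fischer_def sum_nonneg)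

text \<open>Pizzetti's formula for the mean value over the unit sphere, truncated at order \<open>N\<close>. For a
polynomial only finitely many summands are nonzero, so the value is constant for \<open>N\<close>
large; keeping \<open>N\<close> as a parameter makes the mean visibly linear.\<close>

definition mean :: "nat \<Rightarrow> ('v \<Rightarrow> real) \<Rightarrow> real" where
  "mean N f = (\<Sum>k\<le>N. (lap ^^ k) f 0 / lap_coeff 0 k k)"

lemma mean_add: "polyfun f \<Longrightarrow> polyfun g \<Longrightarrow> mean N (\<lambda>v. f v + g v) = mean N f + mean N g"
  by (simp add: mean_def lap_power_add add_divide_distrib sum.distrib)

lemma mean_cmult: "polyfun f \<Longrightarrow> mean N (\<lambda>v. c * f v) = c * mean N f"
  by (simp add: mean_def lap_power_cmult sum_distrib_left)

text \<open>The mean value property of harmonic functions, for \<open>r\<^sup>2\<^sup>k h\<close>, which agrees with \<open>h\<close> on the sphere.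
The \<open>lap_coeff 0 k k\<close> in the denominators of the mean are chosen to make this true for constant \<open>h\<close>.\<close>

lemma mean_r2_power_harmonic:
  assumes "homogeneous j h" "lap h = (\<lambda>v. 0)" "k \<le> N" "E \<noteq> {}"
  shows "mean N (\<lambda>v. r2 v ^ k * h v) = h 0"
proof -
  have r0: "r2 0 = 0" by (simp add: r_squared_inner)
  have "(lap ^^ i) (\<lambda>v. r2 v ^ k * h v) 0 / lap_coeff 0 i i = (if i = k then h 0 else 0)" for i
  proof -
    have val: "(lap ^^ i) (\<lambda>v. r2 v ^ k * h v) 0 = lap_coeff j k i * (0 ^ (k - i) * h 0)"
      using fun_cong[OF lap_power_r2_power_harmonic[OF assms(1,2), of i k], of 0] by (simp only: r0)
    show ?thesis
    proof (cases "j = 0")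
      case j: True
      consider "i < k" | "i = k" | "k < i" by linarith
      then show ?thesis
      proof cases
        case 1
        then show ?thesis unfolding val by simp
      next
        case 2
        then show ?thesis unfolding val using lap_coeff_pos[OF assms(4), of 0 k] j by simp
      next
        case 3
        then show ?thesis unfolding val by (simp add: lap_coeff_zero)
      qed
    next
      case False
      then have "h 0 = 0" using homogeneous_at_0[OF assms(1)] by simp
      then show ?thesis unfolding val by simp
    qed
  qed
  then show ?thesis using assms(3) by (simp add: mean_def)
qed

text \<open>Harmonic polynomials of different degrees are orthogonal on the sphere, and in equal degree the
inner product of the sphere is a multiple of the Fischer inner product.\<close>

lemma mean_mult_harmonic:
  assumes "homogeneous i p" "homogeneous j q" "lap p = (\<lambda>v. 0)" "lap q = (\<lambda>v. 0)"
  shows "i \<noteq> j \<Longrightarrow> mean N (\<lambda>v. p v * q v) = 0"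
    and "i = j \<Longrightarrow> j \<le> N \<Longrightarrow> mean N (\<lambda>v. p v * q v) = 2 ^ j / lap_coeff 0 j j * fischer j p q"
proof -
  have *: "(lap ^^ k) (\<lambda>v. p v * q v) 0 / lap_coeff 0 k k
      = (if k = j then (if i = j then 2 ^ j / lap_coeff 0 j j * fischer j p q else 0) else 0)" for k
    by (auto simp: lap_power_mult_harmonic_at_0[OF assms])
  show "i \<noteq> j \<Longrightarrow> mean N (\<lambda>v. p v * q v) = 0"
    unfolding mean_def * by simp
  show "i = j \<Longrightarrow> j \<le> N \<Longrightarrow> mean N (\<lambda>v. p v * q v) = 2 ^ j / lap_coeff 0 j j * fischer j p q"
    unfolding mean_def * by simp
qed

end


section \<open>Laplacian algebras\<close>

text \<open>Components are indexed by all natural numbers and vanish from some index on, so that two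
decompositions of different length can be added.\<close>

lemma polyfun_homogeneous_decomposition:
  assumes "polyfun f"
  shows "\<exists>F N. (\<forall>k. homogeneous k (F k)) \<and> (\<forall>k>N. F k = (\<lambda>v. 0)) \<and> f = (\<lambda>v. \<Sum>k\<le>N. F k v)"
    (is "?D f")
proof -
  have hom: "?D f" if "homogeneous d f" for d f
  proof (intro exI conjI allI impI)
    show "homogeneous k (\<lambda>v. if k = d then f v else 0)" for k
      using that by (cases "k = d") (simp_all add: homogeneous_zero)
    show "f = (\<lambda>v. \<Sum>k\<le>d. if k = d then f v else 0)" by simp
  qed simp
  have add: "?D (\<lambda>v. f v + g v)" if fg: "?D f" "?D g" for f g
  proof -
    obtain F N where F: "\<And>k. homogeneous k (F k)" "\<And>k. k > N \<Longrightarrow> F k = (\<lambda>v. 0)"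
      "f = (\<lambda>v. \<Sum>k\<le>N. F k v)" using fg(1) by blast
    obtain G M where G: "\<And>k. homogeneous k (G k)" "\<And>k. k > M \<Longrightarrow> G k = (\<lambda>v. 0)"
      "g = (\<lambda>v. \<Sum>k\<le>M. G k v)" using fg(2) by blast
    have "(\<Sum>k\<le>N. F k v) = (\<Sum>k\<le>max N M. F k v)" "(\<Sum>k\<le>M. G k v) = (\<Sum>k\<le>max N M. G k v)" for v
      using F(2) G(2) by (intro sum.mono_neutral_left; simp add: not_le)+
    then show ?thesis using F(1,2) G(1,2) unfolding F(3) G(3)
      by (intro exI[of _ "\<lambda>k v. F k v + G k v"] exI[of _ "max N M"])
         (auto intro: homogeneous_add simp: sum.distrib)
  qed
  have sum: "?D (\<lambda>v. \<Sum>i\<in>I. g i v)" if "finite I" "\<And>i. i \<in> I \<Longrightarrow> ?D (g i)"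
    for I :: "nat set" and g :: "nat \<Rightarrow> 'a \<Rightarrow> real"
    using that
  proof (induction rule: finite_induct)
    case empty
    show ?case using hom[OF homogeneous_const[of 0]] by simp
  next
    case (insert i I)
    have "?D (\<lambda>v. g i v + (\<Sum>i\<in>I. g i v))" by (rule add) (use insert in auto)
    then show ?case using insert.hyps by simp
  qed
  show ?thesis using assms
  proof (induction rule: real_polynomial_function.induct)
    case (linear f)
    then have "homogeneous 1 f" by (simp add: homogeneous_def polyfun_linear linear_simps)
    then show ?case by (rule hom)
  next
    case (const c)
    show ?case by (rule hom[OF homogeneous_const])
  next
    case (add f g)
    then show ?case using \<open>\<And>f g. ?D f \<Longrightarrow> ?D g \<Longrightarrow> ?D (\<lambda>v. f v + g v)\<close> by blast
  next
    case (mult f g)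
    obtain F N where F: "\<And>k. homogeneous k (F k)" "f = (\<lambda>v. \<Sum>k\<le>N. F k v)" using mult.IH(1) by blast
    obtain G M where G: "\<And>k. homogeneous k (G k)" "g = (\<lambda>v. \<Sum>k\<le>M. G k v)" using mult.IH(2) by blast
    have "?D (\<lambda>v. F i v * G j v)" for i j
      by (rule hom[OF homogeneous_mult[OF F(1)[of i] G(1)[of j]]])
    then have "?D (\<lambda>v. \<Sum>i\<le>N. (\<lambda>v. \<Sum>j\<le>M. (\<lambda>v. F i v * G j v) v) v)"
      by (intro sum finite_atMost)
    then show ?case by (simp add: F(2) G(2) sum_product)
  qed
qed

lemma function_subalgebra_lincomb:
  "function_subalgebra C \<Longrightarrow> f \<in> C \<Longrightarrow> g \<in> C \<Longrightarrow> (\<lambda>v. f v + c * g v) \<in> C"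
  by (simp add: function_subalgebra_def)

lemma function_subalgebra_cmult:
  "function_subalgebra C \<Longrightarrow> f \<in> C \<Longrightarrow> (\<lambda>v. c * f v) \<in> C"
  by (simp add: function_subalgebra_def)

lemma function_subalgebra_sum:
  "function_subalgebra C \<Longrightarrow> (\<And>i. i \<in> I \<Longrightarrow> f i \<in> C) \<Longrightarrow> (\<lambda>v. \<Sum>i\<in>I. f i v) \<in> C"
  by (induction I rule: infinite_finite_induct) (simp_all add: function_subalgebra_def)

lemma function_subalgebra_power:
  "function_subalgebra C \<Longrightarrow> f \<in> C \<Longrightarrow> (\<lambda>v. f v ^ k) \<in> C"
  by (induction k) (simp_all add: function_subalgebra_def)

context orthonormal_coordinates
begin

definition laplacian_algebra :: "('v \<Rightarrow> real) set \<Rightarrow> bool" where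
  "laplacian_algebra C \<longleftrightarrow> function_subalgebra C \<and> C \<subseteq> Collect polyfun \<and> r2 \<in> C \<and>
     (\<forall>f\<in>C. lap f \<in> C) \<and> (\<forall>f\<in>C. \<forall>g\<in>C. grad_inner E f g \<in> C)"

lemma laplacian_algebra_polyfuns: "laplacian_algebra (Collect polyfun)"
  by (auto simp: laplacian_algebra_def function_subalgebra_def polyfun_const polyfun_add polyfun_mult
      polyfun_r2 polyfun_lap polyfun_grad)

text \<open>For fixed \<open>f\<close> the map \<open>g \<mapsto> \<langle>\<nabla>f, \<nabla>g\<rangle>\<close> is a derivation, so closure passes from the generators to the
algebra in one argument and then, by symmetry, in the other. The product rule for the Laplacian
involves only these gradient products and the Laplacians of the factors.\<close>

lemma laplacian_algebra_generated:
  assumes S: "S \<subseteq> Collect polyfun" "r2 \<in> S"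
    and lap: "\<And>f. f \<in> S \<Longrightarrow> lap f \<in> generated_subalgebra S"
    and grad: "\<And>f g. f \<in> S \<Longrightarrow> g \<in> S \<Longrightarrow> grad_inner E f g \<in> generated_subalgebra S"
  shows "laplacian_algebra (generated_subalgebra S)"
proof -
  define B where "B = generated_subalgebra S"
  have alg: "function_subalgebra B"
    unfolding B_def generated_subalgebra_def by (rule hull_in) (auto simp: function_subalgebra_def)
  have poly: "B \<subseteq> Collect polyfun"
    unfolding B_def generated_subalgebra_def using laplacian_algebra_polyfuns
    by (intro hull_minimal S) (simp add: laplacian_algebra_def)
  have sub: "S \<subseteq> B" unfolding B_def generated_subalgebra_def by (rule hull_subset)
  have induct: "P f" if "f \<in> B" "\<And>f. f \<in> S \<Longrightarrow> P f" "function_subalgebra {f. P f}" for P f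
    using that hull_induct[of f function_subalgebra S P] by (simp add: B_def generated_subalgebra_def)
  have grad_closed: "grad_inner E f g \<in> B"
    if "g \<in> B" "\<And>g. g \<in> S \<Longrightarrow> grad_inner E f g \<in> B" for f g
  proof -
    have "g \<in> B \<and> grad_inner E f g \<in> B"
    proof (rule induct[OF that(1)])
      show "function_subalgebra {g. g \<in> B \<and> grad_inner E f g \<in> B}"
        using alg poly
        by (auto simp: function_subalgebra_def grad_const_right grad_add_right grad_mult_right subset_iff)
    qed (use that(2) sub in auto)
    then show ?thesis ..
  qed
  have "grad_inner E f g \<in> B" if "f \<in> B" "g \<in> S" for f g
    using grad_closed[OF that(1), of g] grad that(2) by (simp add: B_def grad_commute)
  then have grad_B: "grad_inner E f g \<in> B" if "f \<in> B" "g \<in> B" for f g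
    using grad_closed that by blast
  have "f \<in> B \<and> lap f \<in> B" if "f \<in> B" for f
  proof (rule induct[OF that])
    have "(\<lambda>v. f v * lap g v + lap f v * g v + 2 * grad_inner E f g v) \<in> B"
      if "f \<in> B" "g \<in> B" "lap f \<in> B" "lap g \<in> B" for f g
      using alg that grad_B[OF that(1,2)] unfolding function_subalgebra_def by auto
    then show "function_subalgebra {f. f \<in> B \<and> lap f \<in> B}"
      using alg poly
      by (auto simp: function_subalgebra_def lap_fun[of "\<lambda>v. _"] lap_add lap_mult partial_deriv_const subset_iff)
  qed (use lap sub in \<open>auto simp: B_def\<close>)
  then show ?thesis
    using alg poly sub S(2) grad_B by (auto simp: laplacian_algebra_def B_def[symmetric])
qed

lemma grad_sum_right:
  assumes "finite I" "\<And>i. i \<in> I \<Longrightarrow> polyfun (g i)"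
  shows "grad_inner E f (\<lambda>v. \<Sum>i\<in>I. g i v) = (\<lambda>v. \<Sum>i\<in>I. grad_inner E f (g i) v)"
  using assms
proof (induction rule: finite_induct)
  case empty
  then show ?case by (simp add: grad_const_right)
next
  case (insert i I)
  then show ?case by (simp add: grad_add_right real_polynomial_function_sum)
qed

text \<open>The Euler operator minus \<open>N + 1\<close> annihilates the component of degree \<open>N + 1\<close> and multiplies the
others by nonzero scalars, so induction applies to what remains.\<close>

lemma homogeneous_components_mem:
  assumes C: "laplacian_algebra C"
    and "\<And>k. k \<le> N \<Longrightarrow> homogeneous k (F k)" "(\<lambda>v. \<Sum>k\<le>N. F k v) \<in> C" "k \<le> N"
  shows "F k \<in> C"
  using assms(2-4)
proof (induction N arbitrary: F k)
  case 0
  then show ?case by simp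
next
  case (Suc N)
  have alg: "function_subalgebra C" using C by (simp add: laplacian_algebra_def)
  let ?f = "\<lambda>v. \<Sum>k\<le>Suc N. F k v"
  have "grad_inner E r2 ?f = (\<lambda>v. \<Sum>k\<le>Suc N. grad_inner E r2 (F k) v)"
    using Suc.prems(1) by (intro grad_sum_right) (auto intro: homogeneous_polyfun)
  also have "\<dots> = (\<lambda>v. \<Sum>k\<le>Suc N. 2 * real k * F k v)"
    using grad_r2[OF Suc.prems(1)] by (intro ext sum.cong refl) simp
  finally have "(\<lambda>v. \<Sum>k\<le>Suc N. 2 * real k * F k v) \<in> C"
    using C Suc.prems(2) unfolding laplacian_algebra_def by metis
  then have "(\<lambda>v. (\<Sum>k\<le>Suc N. 2 * real k * F k v) + (- 2 * real (Suc N)) * ?f v) \<in> C"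
    using function_subalgebra_lincomb[OF alg] Suc.prems(2) by blast
  also have "(\<lambda>v. (\<Sum>k\<le>Suc N. 2 * real k * F k v) + (- 2 * real (Suc N)) * ?f v) =
      (\<lambda>v. \<Sum>k\<le>N. (2 * real k - 2 * real (Suc N)) * F k v)"
    unfolding sum_distrib_left sum.distrib[symmetric] by (simp add: algebra_simps)
  finally have "(\<lambda>v. \<Sum>k\<le>N. (2 * real k - 2 * real (Suc N)) * F k v) \<in> C" .
  from Suc.IH[OF _ this]
  have *: "(\<lambda>v. (2 * real k - 2 * real (Suc N)) * F k v) \<in> C" if "k \<le> N" for k
    using that homogeneous_cmult[OF Suc.prems(1)] by simp
  have lower: "F k \<in> C" if "k \<le> N" for k
    using function_subalgebra_cmult[OF alg *[OF that], of "1 / (2 * real k - 2 * real (Suc N))"] that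
    by simp
  have "(\<lambda>v. \<Sum>k\<le>N. F k v) \<in> C" using lower by (intro function_subalgebra_sum alg) auto
  from function_subalgebra_lincomb[OF alg Suc.prems(2) this, of "-1"] have "F (Suc N) \<in> C" by simp
  then show ?case using lower Suc.prems(3) by (cases "k = Suc N") auto
qed

text \<open>For homogeneous \<open>f\<close> with \<open>\<Delta>\<^sup>k\<^sup>+\<^sup>1 f = 0\<close>, the polynomial \<open>\<Delta>\<^sup>k f\<close> is harmonic, and a suitable
multiple \<open>g\<close> of it satisfies \<open>\<Delta>\<^sup>k (r\<^sup>2\<^sup>k g) = \<Delta>\<^sup>k f\<close>; subtracting \<open>r\<^sup>2\<^sup>k g\<close> from \<open>f\<close> lowers \<open>k\<close>. As
\<open>g\<close> stays in the algebra, this writes \<open>f\<close> as a sum of terms \<open>r\<^sup>2\<^sup>k h\<close> with \<open>h\<close> in the algebra,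
harmonic and homogeneous.\<close>

lemma laplacian_algebra_induct [consumes 3, case_names harmonic add]:
  assumes C: "laplacian_algebra C" and E: "E \<noteq> {}" and f: "f \<in> C"
    and harmonic: "\<And>k j h. h \<in> C \<Longrightarrow> homogeneous j h \<Longrightarrow> lap h = (\<lambda>v. 0) \<Longrightarrow> P (\<lambda>v. r2 v ^ k * h v)"
    and add: "\<And>f g. f \<in> C \<Longrightarrow> g \<in> C \<Longrightarrow> P f \<Longrightarrow> P g \<Longrightarrow> P (\<lambda>v. f v + g v)"
  shows "P f"
proof -
  have alg: "function_subalgebra C" and r2: "r2 \<in> C" using C by (simp_all add: laplacian_algebra_def)
  have zero: "(\<lambda>v. 0) \<in> C" using alg by (simp add: function_subalgebra_def)
  have P_zero: "P (\<lambda>v. 0)" using harmonic[OF zero homogeneous_zero[of 0] lap_zero, of 0] by simp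
  have lap_power: "(lap ^^ k) f \<in> C" if "f \<in> C" for k f
    using that C by (induction k) (auto simp: laplacian_algebra_def)
  \<comment> \<open>For \<open>f\<close> homogeneous of degree \<open>m\<close> the hypothesis holds once \<open>2 k > m\<close>.\<close>
  have hom: "P f" if "f \<in> C" "homogeneous m f" "(lap ^^ k) f = (\<lambda>v. 0)" for m k f
    using that
  proof (induction k arbitrary: f)
    case 0
    then show ?case using P_zero by simp
  next
    case (Suc k)
    show ?case
    proof (cases "2 * k \<le> m")
      case False
      then have "(lap ^^ k) f = (\<lambda>v. 0)" using homogeneous_lap_power[OF Suc.prems(2), of k] by simp
      then show ?thesis using Suc by simp
    next
      case True
      define c where "c = 1 / lap_coeff (m - 2 * k) k k"
      define g where "g = (\<lambda>v. c * (lap ^^ k) f v)"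
      have "homogeneous (m - 2 * k) ((lap ^^ k) f)"
        using homogeneous_lap_power[OF Suc.prems(2), of k] True by simp
      then have g: "homogeneous (m - 2 * k) g" "lap g = (\<lambda>v. 0)"
        unfolding g_def using Suc.prems(3)
        by (auto intro: homogeneous_cmult simp: lap_cmult[OF homogeneous_polyfun])
      have gC: "g \<in> C"
        unfolding g_def by (intro function_subalgebra_cmult alg lap_power Suc.prems)
      let ?t = "\<lambda>v. r2 v ^ k * g v"
      have t: "homogeneous m ?t" using homogeneous_r2_power_mult[OF g(1), of k] True by simp
      have tC: "?t \<in> C"
        using alg function_subalgebra_power[OF alg r2, of k] gC by (simp add: function_subalgebra_def)
      have "(lap ^^ k) ?t = (\<lambda>v. lap_coeff (m - 2 * k) k k * (r2 v ^ (k - k) * g v))"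
        by (rule lap_power_r2_power_harmonic[OF g])
      also have "\<dots> = (lap ^^ k) f"
        using lap_coeff_pos[OF E, of "m - 2 * k" k] by (simp add: g_def c_def)
      finally have "(lap ^^ k) ?t = (lap ^^ k) f" .
      then have "(lap ^^ k) (\<lambda>v. f v + (-1) * ?t v) = (\<lambda>v. 0)"
        using lap_power_add[OF homogeneous_polyfun homogeneous_polyfun, OF Suc.prems(2) homogeneous_cmult[OF t, of "-1"], of k]
          lap_power_cmult[OF homogeneous_polyfun[OF t], of k "-1"] by simp
      moreover have "(\<lambda>v. f v + (-1) * ?t v) \<in> C" "homogeneous m (\<lambda>v. f v + (-1) * ?t v)"
        using function_subalgebra_lincomb[OF alg Suc.prems(1) tC, of "-1"]
          homogeneous_add[OF Suc.prems(2) homogeneous_cmult[OF t, of "-1"]] by blast+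
      ultimately have "P (\<lambda>v. f v + (-1) * ?t v)" "(\<lambda>v. f v + (-1) * ?t v) \<in> C"
        using Suc.IH by blast+
      from add[OF this(2) tC this(1) harmonic[OF gC g]] show ?thesis by simp
    qed
  qed
  obtain F N where F: "\<And>k. homogeneous k (F k)" "f = (\<lambda>v. \<Sum>k\<le>N. F k v)"
    using polyfun_homogeneous_decomposition[of f] C f unfolding laplacian_algebra_def by blast
  have FC: "F k \<in> C" if "k \<le> N" for k
    using homogeneous_components_mem[OF C, of N F] F f that by blast
  have PF: "P (F k)" if "k \<le> N" for k
  proof (rule hom[OF FC[OF that] F(1)])
    show "(lap ^^ Suc k) (F k) = (\<lambda>v. 0)" using homogeneous_lap_power[OF F(1)[of k], of "Suc k"] by simp
  qed
  have "P (\<lambda>v. \<Sum>k\<le>M. F k v) \<and> (\<lambda>v. \<Sum>k\<le>M. F k v) \<in> C" if "M \<le> N" for M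
    using that
  proof (induction M)
    case 0
    then show ?case using PF[of 0] FC[of 0] by simp
  next
    case (Suc M)
    then show ?case using add[of "\<lambda>v. \<Sum>k\<le>M. F k v" "F (Suc M)"] PF[of "Suc M"] FC[of "Suc M"] alg
      by (simp add: function_subalgebra_def)
  qed
  then show ?thesis using F(2) by simp
qed

lemma r2_on_sphere: "norm v = 1 \<Longrightarrow> r2 v = 1"
  by (simp add: r_squared_inner norm_eq_1)

text \<open>Replacing each term \<open>r\<^sup>2\<^sup>k h\<close> of \<open>f\<close> by \<open>h\<close> gives a harmonic polynomial that agrees with \<open>f\<close> on the
sphere and takes the mean of \<open>f\<close> as its value at the origin.\<close>

lemma mean_le_sphere:
  assumes "polyfun f" "E \<noteq> {}"
  shows "\<exists>N0. \<forall>N\<ge>N0. \<forall>M. (\<forall>v. norm v = 1 \<longrightarrow> f v \<le> M) \<longrightarrow> mean N f \<le> M"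
proof -
  have "f \<in> Collect polyfun" using assms by simp
  with laplacian_algebra_polyfuns assms(2)
  have "\<exists>H N0. polyfun H \<and> lap H = (\<lambda>v. 0) \<and> (\<forall>v. norm v = 1 \<longrightarrow> H v = f v) \<and> (\<forall>N\<ge>N0. mean N f = H 0)"
  proof (induction rule: laplacian_algebra_induct)
    case (harmonic k j h)
    then show ?case
      by (intro exI[of _ h] exI[of _ k])
         (auto simp: mean_r2_power_harmonic assms(2) r2_on_sphere homogeneous_polyfun)
  next
    case (add f g)
    obtain H N where H: "polyfun H" "lap H = (\<lambda>v. 0)" "\<And>v. norm v = 1 \<Longrightarrow> H v = f v"
      "\<And>n. n \<ge> N \<Longrightarrow> mean n f = H 0" using add.IH(1) by blast
    obtain K M where K: "polyfun K" "lap K = (\<lambda>v. 0)" "\<And>v. norm v = 1 \<Longrightarrow> K v = g v"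
      "\<And>n. n \<ge> M \<Longrightarrow> mean n g = K 0" using add.IH(2) by blast
    show ?case using H K add.hyps
      by (intro exI[of _ "\<lambda>v. H v + K v"] exI[of _ "max N M"]) (auto simp: polyfun_add lap_add mean_add)
  qed
  then obtain H N0 where H: "polyfun H" "lap H = (\<lambda>v. 0)" "\<And>v. norm v = 1 \<Longrightarrow> H v = f v"
    "\<And>N. N \<ge> N0 \<Longrightarrow> mean N f = H 0" by blast
  then show ?thesis
    using harmonic_center_le_sphere[OF H(1,2) assms(2)] by (intro exI[of _ N0]) simp
qed

text \<open>The difference \<open>u\<close> of \<open>h\<close> and its projection to the harmonic elements of degree \<open>d\<close> in \<open>B\<close> is
orthogonal on the sphere to all of \<open>B\<close>. Since \<open>B\<close> comes uniformly close to \<open>u\<close>, the mean of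
\<open>u\<^sup>2\<close> is zero.\<close>

lemma harmonic_mem_separating_subalgebra:
  assumes A: "laplacian_algebra A" and B: "laplacian_algebra B" "B \<subseteq> A" and E: "E \<noteq> {}"
    and sep: "\<And>f x y. f \<in> A \<Longrightarrow> f x \<noteq> f y \<Longrightarrow> \<exists>g\<in>B. g x \<noteq> g y"
    and h: "h \<in> A" "homogeneous d h" "lap h = (\<lambda>v. 0)"
  shows "h \<in> B"
proof -
  have algA: "function_subalgebra A" and algB: "function_subalgebra B"
    using A B by (simp_all add: laplacian_algebra_def)
  have poly: "polyfun f" if "f \<in> B" for f using that B(1) by (auto simp: laplacian_algebra_def)
  define W where "W = {p\<in>B. homogeneous d p \<and> lap p = (\<lambda>v. 0)}"
  define L where "L p = (\<lambda>w. iter_deriv w p 0)" for p :: "'v \<Rightarrow> real"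
  have lap_lincomb: "lap (\<lambda>v. p v + c * q v) = (\<lambda>v. 0)"
    if "polyfun p" "polyfun q" "lap p = (\<lambda>v. 0)" "lap q = (\<lambda>v. 0)" for p q c
    using that by (simp add: lap_add lap_cmult polyfun_mult polyfun_const)
  have "(\<lambda>w. L p w + c * L q w) \<in> L ` W" if "p \<in> W" "q \<in> W" for p q c
  proof (rule image_eqI)
    have pq: "polyfun p" "polyfun q" using that poly by (auto simp: W_def)
    show "(\<lambda>w. L p w + c * L q w) = L (\<lambda>v. p v + c * q v)"
      by (simp add: L_def iter_deriv_lincomb pq)
    show "(\<lambda>v. p v + c * q v) \<in> W"
      using that pq by (auto simp: W_def lap_lincomb function_subalgebra_lincomb[OF algB]
          intro!: homogeneous_add homogeneous_cmult)
  qed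
  moreover have "(\<lambda>v. 0) \<in> W"
    using algB by (simp add: W_def function_subalgebra_def homogeneous_zero lap_zero)
  ultimately have "\<exists>x\<in>L ` W. \<forall>y\<in>L ` W. (\<Sum>w\<in>words d. (L h w - x w) * y w) = 0"
    by (intro orthogonal_projection_exists finite_words) auto
  then obtain p where p: "p \<in> W" "\<And>q. q \<in> W \<Longrightarrow> (\<Sum>w\<in>words d. (L h w - L p w) * L q w) = 0"
    by auto
  define u where "u v = h v + (-1) * p v" for v
  have poly_hp: "polyfun h" "polyfun p" using h p(1) by (auto simp: W_def intro: homogeneous_polyfun)
  have u: "u \<in> A" "homogeneous d u" "lap u = (\<lambda>v. 0)"
    using h p(1) B(2) function_subalgebra_lincomb[OF algA, of h p "-1"]
      homogeneous_add[OF h(2) homogeneous_cmult[of d p "-1"]] lap_lincomb[OF poly_hp, of "-1"]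
    by (auto simp: W_def u_def[abs_def])
  have poly_u: "polyfun u" using u(2) by (rule homogeneous_polyfun)
  have orth: "fischer d q u = 0" if "q \<in> W" for q
  proof -
    have "iter_deriv w q 0 * iter_deriv w u 0 = (L h w - L p w) * L q w" for w
      using iter_deriv_lincomb[OF poly_hp, of w "-1"] by (simp add: L_def u_def[abs_def])
    then show ?thesis using p(2)[OF that] by (simp add: fischer_def)
  qed
  have "fischer d u u = 0"
  proof (rule ccontr)
    assume "fischer d u u \<noteq> 0"
    moreover define \<mu> where "\<mu> = 2 ^ d / lap_coeff 0 d d * fischer d u u"
    ultimately have pos: "0 < \<mu>"
      using fischer_nonneg[of d u] lap_coeff_pos[OF E, of 0 d] by simp
    have "bounded (u ` {v. norm v = 1})"
      using compact_sphere continuous_on_polyfun[OF poly_u]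
      by (intro compact_imp_bounded compact_continuous_image)
    then obtain K where K: "0 < K" "\<And>v. norm v = 1 \<Longrightarrow> \<bar>u v\<bar> \<le> K"
      by (auto simp: bounded_pos)
    \<comment> \<open>The mean of \<open>u\<^sup>2\<close> is \<open>\<mu>\<close>, but it will turn out to be at most \<open>\<epsilon> K = \<mu> / 2\<close>.\<close>
    define \<epsilon> where "\<epsilon> = \<mu> / (2 * K)"
    have \<epsilon>: "0 < \<epsilon>" using pos K by (simp add: \<epsilon>_def)
    obtain b where b: "b \<in> B" "\<And>v. norm v = 1 \<Longrightarrow> \<bar>u v - b v\<bar> < \<epsilon>"
      using Stone_Weierstrass_fibres[OF compact_sphere algB continuous_on_polyfun[OF poly]
          continuous_on_polyfun[OF poly_u] sep[OF u(1)] \<epsilon>] by auto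
    \<comment> \<open>Dropping the powers of \<open>r\<^sup>2\<close> from \<open>b\<close> keeps its values on the sphere and leaves a sum of
      harmonic elements of \<open>B\<close>: those of degree \<open>d\<close> belong to \<open>W\<close>, and the others have a different
      degree from \<open>u\<close>. All are orthogonal to \<open>u\<close>.\<close>
    from B(1) E b(1)
    have "\<exists>b'. polyfun b' \<and> (\<forall>v. norm v = 1 \<longrightarrow> b' v = b v) \<and> (\<forall>N\<ge>d. mean N (\<lambda>v. b' v * u v) = 0)"
    proof (induction rule: laplacian_algebra_induct)
      case (harmonic k j \<beta>)
      have "mean N (\<lambda>v. \<beta> v * u v) = 0" if "d \<le> N" for N
      proof (cases "j = d")
        case True
        then have "fischer d \<beta> u = 0" using harmonic by (intro orth) (simp add: W_def)
        then show ?thesis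
          using mean_mult_harmonic(2)[OF harmonic(2) u(2) harmonic(3) u(3) True that] True by simp
      next
        case False
        then show ?thesis using mean_mult_harmonic(1)[OF harmonic(2) u(2) harmonic(3) u(3)] by blast
      qed
      then show ?case using homogeneous_polyfun[OF harmonic(2)]
        by (intro exI[of _ \<beta>]) (simp add: r2_on_sphere)
    next
      case (add f g)
      obtain f' where f': "polyfun f'" "\<And>v. norm v = 1 \<Longrightarrow> f' v = f v"
        "\<And>N. d \<le> N \<Longrightarrow> mean N (\<lambda>v. f' v * u v) = 0" using add.IH(1) by blast
      obtain g' where g': "polyfun g'" "\<And>v. norm v = 1 \<Longrightarrow> g' v = g v"
        "\<And>N. d \<le> N \<Longrightarrow> mean N (\<lambda>v. g' v * u v) = 0" using add.IH(2) by blast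
      show ?case using f' g'
        by (intro exI[of _ "\<lambda>v. f' v + g' v"])
           (simp add: distrib_right mean_add polyfun_add polyfun_mult poly_u)
    qed
    then obtain b' where b': "polyfun b'" "\<And>v. norm v = 1 \<Longrightarrow> b' v = b v"
      "\<And>N. d \<le> N \<Longrightarrow> mean N (\<lambda>v. b' v * u v) = 0" by blast
    let ?f = "\<lambda>v. u v * u v + (-1) * (b' v * u v)"
    have poly_uu: "polyfun (\<lambda>v. u v * u v)" and poly_bu: "polyfun (\<lambda>v. b' v * u v)"
      using poly_u b'(1) by (intro polyfun_mult; simp)+
    have poly_f: "polyfun ?f" by (intro polyfun_add poly_uu polyfun_mult[OF polyfun_const poly_bu])
    obtain N0 where N0: "\<And>N M. N0 \<le> N \<Longrightarrow> (\<And>v. norm v = 1 \<Longrightarrow> ?f v \<le> M) \<Longrightarrow> mean N ?f \<le> M"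
      using mean_le_sphere[OF poly_f E] by blast
    define N where "N = max d N0"
    have "?f v \<le> \<epsilon> * K" if "norm v = 1" for v
    proof -
      have "?f v = (u v - b v) * u v" using b'(2)[OF that] by (simp add: algebra_simps)
      also have "\<dots> \<le> \<bar>u v - b v\<bar> * \<bar>u v\<bar>" by (metis abs_ge_self abs_mult)
      also have "\<dots> \<le> \<epsilon> * K" using b(2)[OF that] K(2)[OF that] \<epsilon> by (intro mult_mono) auto
      finally show ?thesis .
    qed
    then have "mean N ?f \<le> \<epsilon> * K" by (intro N0) (auto simp: N_def)
    moreover have "mean N ?f = \<mu>"
    proof -
      have "mean N ?f = mean N (\<lambda>v. u v * u v) + (-1) * mean N (\<lambda>v. b' v * u v)"
        using mean_add[OF poly_uu polyfun_mult[OF polyfun_const poly_bu], of N "-1"]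
          mean_cmult[OF poly_bu, of N "-1"] by simp
      also have "\<dots> = \<mu>"
        using mean_mult_harmonic(2)[OF u(2) u(2) u(3) u(3) refl, of N] b'(3)[of N]
        by (simp add: \<mu>_def N_def)
      finally show ?thesis .
    qed
    ultimately show False using pos K(1) by (simp add: \<epsilon>_def)
  qed
  then have "u = (\<lambda>v. 0)" by (rule fischer_definite[OF u(2)])
  then have "h = p" by (auto simp: u_def fun_eq_iff)
  then show ?thesis using p(1) by (simp add: W_def)
qed

text \<open>The harmonic elements of \<open>A\<close> lie in \<open>B\<close>, and together with \<open>r\<^sup>2\<close> they generate \<open>A\<close>. In dimension
zero, where \<open>r\<^sup>2\<close> vanishes and there is no sphere, all functions are constant.\<close>

lemma laplacian_algebra_eq_if_same_fibres:
  assumes A: "laplacian_algebra A" and B: "laplacian_algebra B" "B \<subseteq> A"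
    and sep: "\<And>f x y. f \<in> A \<Longrightarrow> f x \<noteq> f y \<Longrightarrow> \<exists>g\<in>B. g x \<noteq> g y"
  shows "B = A"
proof
  have algB: "function_subalgebra B" and r2: "r2 \<in> B"
    using B by (simp_all add: laplacian_algebra_def)
  show "A \<subseteq> B"
  proof
    fix f assume f: "f \<in> A"
    show "f \<in> B"
    proof (cases "E = {}")
      case True
      then have "v = 0" for v :: 'v using expansion[of v] by simp
      then have "f = (\<lambda>v. f 0)" by metis
      then show ?thesis using algB unfolding function_subalgebra_def by metis
    next
      case False
      from A False f show ?thesis
      proof (induction rule: laplacian_algebra_induct)
        case (harmonic k j h)
        have "h \<in> B" by (rule harmonic_mem_separating_subalgebra[OF A B False sep harmonic])
        then show ?case
          using algB function_subalgebra_power[OF algB r2, of k] by (simp add: function_subalgebra_def)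
      next
        case (add f g)
        then show ?case using algB by (simp add: function_subalgebra_def)
      qed
    qed
  qed
qed (rule B(2))

section \<open>Invariants of orthogonal groups\<close>

text \<open>The trace of a bilinear form is the same in every orthonormal basis; the images of the basis
vectors under \<open>T\<close> form one.\<close>

lemma trace_orthogonal_transformation:
  fixes T :: "'v \<Rightarrow> 'v" and q :: "'v \<Rightarrow> 'v \<Rightarrow> real"
  assumes T: "orthogonal_transformation T" "surj T"
    and q: "\<And>b. linear (\<lambda>a. q a b)" "\<And>a. linear (q a)"
  shows "(\<Sum>e\<in>E. q (T e) (T e)) = (\<Sum>e\<in>E. q e e)"
proof -
  have parseval_T: "(\<Sum>e\<in>E. (T e \<bullet> a) * (T e \<bullet> b)) = a \<bullet> b" for a b
  proof -
    obtain a' b' where "a = T a'" "b = T b'" using T(2) by (metis surjD)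
    then show ?thesis
      using T(1) parseval[of a' b'] by (simp add: orthogonal_transformation_def inner_commute)
  qed
  have "q (T e) (T e) = (\<Sum>a\<in>E. \<Sum>b\<in>E. (T e \<bullet> a) * (T e \<bullet> b) * q a b)" for e
    using linear_expansion[OF q(1), of "T e" "T e"] linear_expansion[OF q(2), of _ "T e"]
    by (simp add: sum_distrib_left mult.assoc)
  then have "(\<Sum>e\<in>E. q (T e) (T e)) = (\<Sum>e\<in>E. \<Sum>a\<in>E. \<Sum>b\<in>E. (T e \<bullet> a) * (T e \<bullet> b) * q a b)"
    by simp
  also have "\<dots> = (\<Sum>a\<in>E. \<Sum>e\<in>E. \<Sum>b\<in>E. (T e \<bullet> a) * (T e \<bullet> b) * q a b)"
    by (rule sum.swap)
  also have "\<dots> = (\<Sum>a\<in>E. \<Sum>b\<in>E. \<Sum>e\<in>E. (T e \<bullet> a) * (T e \<bullet> b) * q a b)"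
    by (intro sum.cong refl sum.swap)
  also have "\<dots> = (\<Sum>a\<in>E. \<Sum>b\<in>E. (a \<bullet> b) * q a b)"
    by (simp add: parseval_T flip: sum_distrib_right)
  also have "\<dots> = (\<Sum>a\<in>E. \<Sum>b\<in>E. if a = b then q a b else 0)"
    by (intro sum.cong refl) (simp add: inner_E)
  finally show ?thesis by simp
qed

lemma partial_deriv_equivariant:
  assumes "orthogonal_transformation T" "\<And>v. g v = g' (T v)"
  shows "partial_deriv e g v = partial_deriv (T e) g' (T v)"
  using orthogonal_transformation_linear[OF assms(1)]
  by (simp add: partial_deriv_def assms(2) linear_add linear_cmul)

text \<open>By equivariance, the value at \<open>v\<close> of the Laplacian of an invariant \<open>f\<close> is a trace of its second
derivatives at \<open>\<rho> g v\<close> in the basis transported by \<open>\<rho> g\<close>, and traces do not depend on the basis.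
The same holds for the inner product of gradients.\<close>

lemma laplacian_algebra_invariant_polys:
  assumes "group_action G UNIV \<rho>" "\<And>g. g \<in> carrier G \<Longrightarrow> orthogonal_transformation (\<rho> g)"
  shows "laplacian_algebra (invariant_polys G \<rho>)"
proof -
  let ?A = "invariant_polys G \<rho>"
  have surj: "surj (\<rho> g)" if "g \<in> carrier G" for g
    using group_action.surj_prop[OF assms(1) that] .
  have "lap f \<in> ?A" if f: "f \<in> ?A" for f
    unfolding invariant_polys_def
  proof (intro CollectI conjI ballI allI)
    have poly: "polyfun f" using f by (simp add: invariant_polys_def)
    then show "polyfun (lap f)" by (rule polyfun_lap)
    fix g v assume g: "g \<in> carrier G"
    note T = assms(2)[OF g]
    have "f v = f (\<rho> g v)" for v using f g by (simp add: invariant_polys_def)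
    then have "lap f v = (\<Sum>e\<in>E. partial_deriv (\<rho> g e) (partial_deriv (\<rho> g e) f) (\<rho> g v))"
      unfolding laplacian_def by (intro sum.cong refl partial_deriv_equivariant T)
    also have "\<dots> = lap f (\<rho> g v)"
      unfolding laplacian_def
    proof (rule trace_orthogonal_transformation[OF T surj[OF g],
          where q="\<lambda>a b. partial_deriv a (partial_deriv b f) (\<rho> g v)"])
      show "linear (\<lambda>a. partial_deriv a (partial_deriv b f) (\<rho> g v))" for b
        by (intro partial_deriv_direction_linear polyfun_partial_deriv poly)
      then show "linear (\<lambda>b. partial_deriv a (partial_deriv b f) (\<rho> g v))" for a
        by (simp add: partial_deriv_commute[OF poly, of a])
    qed
    finally show "lap f (\<rho> g v) = lap f v" ..
  qed
  moreover have "grad_inner E f f' \<in> ?A" if f: "f \<in> ?A" "f' \<in> ?A" for f f'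
    unfolding invariant_polys_def
  proof (intro CollectI conjI ballI allI)
    have poly: "polyfun f" "polyfun f'" using f by (simp_all add: invariant_polys_def)
    then show "polyfun (grad_inner E f f')" by (rule polyfun_grad)
    fix g v assume g: "g \<in> carrier G"
    note T = assms(2)[OF g]
    have "f v = f (\<rho> g v)" "f' v = f' (\<rho> g v)" for v using f g by (simp_all add: invariant_polys_def)
    then have "grad_inner E f f' v =
        (\<Sum>e\<in>E. partial_deriv (\<rho> g e) f (\<rho> g v) * partial_deriv (\<rho> g e) f' (\<rho> g v))"
      unfolding grad_inner_def
      by (intro sum.cong refl arg_cong2[where f="(*)"] partial_deriv_equivariant T)
    also have "\<dots> = grad_inner E f f' (\<rho> g v)"
      unfolding grad_inner_def
    proof (rule trace_orthogonal_transformation[OF T surj[OF g],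
          where q="\<lambda>a b. partial_deriv a f (\<rho> g v) * partial_deriv b f' (\<rho> g v)"])
      have lin: "linear (\<lambda>a. partial_deriv a f (\<rho> g v))" "linear (\<lambda>a. partial_deriv a f' (\<rho> g v))"
        by (intro partial_deriv_direction_linear poly)+
      show "linear (\<lambda>a. partial_deriv a f (\<rho> g v) * partial_deriv b f' (\<rho> g v))" for b
        using linear_compose_scale_right[OF lin(1), of "partial_deriv b f' (\<rho> g v)"]
        by (simp add: mult.commute)
      show "linear (\<lambda>b. partial_deriv a f (\<rho> g v) * partial_deriv b f' (\<rho> g v))" for a
        using linear_compose_scale_right[OF lin(2), of "partial_deriv a f (\<rho> g v)"] by simp
    qed
    finally show "grad_inner E f f' (\<rho> g v) = grad_inner E f f' v" ..
  qed
  moreover have "r2 \<in> ?A"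
    using assms(2) polyfun_r2 by (simp add: invariant_polys_def r_squared_inner orthogonal_transformation_def)
  moreover have "function_subalgebra ?A"
    by (auto simp: function_subalgebra_def invariant_polys_def polyfun_const polyfun_add polyfun_mult)
  ultimately show ?thesis by (auto simp: laplacian_algebra_def invariant_polys_def)
qed

end

theorem corollary4:
  fixes G :: "('g, 'm) monoid_scheme" and T :: "'g topology"
    and \<rho> :: "'g \<Rightarrow> 'v \<Rightarrow> 'v::real_inner"
    and E :: "'v set" and S B :: "('v \<Rightarrow> real) set"
  assumes "orthonormal_basis E"
    and "compact_group G T"
    and "orthogonal_representation G T \<rho>"
    and "separating G \<rho> S"
    and "r_squared E \<in> S"
    and "B = generated_subalgebra S"
  shows "B = invariant_polys G \<rho> \<longleftrightarrow>
    (\<forall>f\<in>S. \<forall>g\<in>S. laplacian E f \<in> B \<and> grad_inner E f g \<in> B)"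
proof -
  interpret orthonormal_coordinates E by unfold_locales (rule assms(1))
  let ?A = "invariant_polys G \<rho>"
  have act: "group_action G UNIV \<rho>" using assms(3) by (simp add: orthogonal_representation_def)
  have A: "laplacian_algebra ?A"
    using assms(3) by (intro laplacian_algebra_invariant_polys) (auto simp: orthogonal_representation_def)
  have SA: "S \<subseteq> ?A" using assms(4) by (simp add: separating_def)
  have SB: "S \<subseteq> B" unfolding assms(6) generated_subalgebra_def by (rule hull_subset)
  have BA: "B \<subseteq> ?A" unfolding assms(6) generated_subalgebra_def
    using SA A by (intro hull_minimal) (simp_all add: laplacian_algebra_def)
  show ?thesis
  proof
    assume "B = ?A"
    then show "\<forall>f\<in>S. \<forall>g\<in>S. laplacian E f \<in> B \<and> grad_inner E f g \<in> B"
      using A SA by (simp add: laplacian_algebra_def subset_iff)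
  next
    assume closed: "\<forall>f\<in>S. \<forall>g\<in>S. laplacian E f \<in> B \<and> grad_inner E f g \<in> B"
    have B: "laplacian_algebra B"
      unfolding assms(6)
      by (rule laplacian_algebra_generated)
         (use SA closed assms(5,6) in \<open>auto simp: invariant_polys_def\<close>)
    show "B = ?A"
    proof (rule laplacian_algebra_eq_if_same_fibres[OF A B BA])
      fix f x y assume f: "f \<in> ?A" "f x \<noteq> f y"
      have "orbit G \<rho> x \<noteq> orbit G \<rho> y"
      proof
        assume "orbit G \<rho> x = orbit G \<rho> y"
        moreover have "y \<in> orbit G \<rho> y"
          using group_action.orbit_refl[OF act, of y] by simp
        ultimately obtain g where "g \<in> carrier G" "y = \<rho> g x" by (auto simp: orbit_def)
        then show False using f by (simp add: invariant_polys_def)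
      qed
      then show "\<exists>g\<in>B. g x \<noteq> g y" using assms(4) SB unfolding separating_def by blast
    qed
  qed
qed

end
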